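(* Let $A$ be a $3\times3$ indecomposable elemental admissible matrix (with parity $p$) having a singular isotropic index, and suppose $\mathfrak g(A)$ has finite growth. Then, after reordering indices and multiplying rows by nonzero scalars, $(A,p)$ is one of: $S(1,2,0)$: $A=\begin{pmatrix}0&0&1\\-1&2&-1\\1&-2&0\end{pmatrix}$, $p=(1,0,1)$; or $D(2,1,0)$: $A=\begin{pmatrix}0&0&1\\-1&2&0\\-1&0&2\end{pmatrix}$, $p=(1,0,0)$.
   Context: Let $I=\{1,\dots,n\}$, let $A=(a_{ij})_{i,j\in I}$ be a complex $n\times n$ matrix and $p:I\to\mathbb Z_2$ a parity function. Fix a complex vector space $\mathfrak h$ of dimension $n+\operatorname{corank}(A)$, linearly independent $\alpha_1,\dots,\alpha_n\in\mathfrak h^*$ and $h_1,\dots,h_n\in\mathfrak h$ with $\alpha_j(h_i)=a_{ij}$. Let $\bar{\mathfrak g}(A)$ be the Lie superalgebra generated by $\mathfrak h$ (even, abelian) and elements $X_i,Y_i$ ($i\in I$) of parity $p(i)$ subject to $[h,X_i]=\alpha_i(h)X_i$, $[h,Y_i]=-\alpha_i(h)Y_i$, $[X_i,Y_j]=\delta_{ij}h_i$. The contragredient Lie superalgebra $\mathfrak g(A)$ is the quotient of $\bar{\mathfrak g}(A)$ by the unique maximal ideal meeting $\mathfrak h$ trivially. Finite growth: $\dim\mathfrak g_m$ in the principal grading ($\deg X_i=1,\deg Y_i=-1,\deg\mathfrak h=0$) is polynomially bounded. $A$ is elemental if it has no zero row; indecomposable if $I$ is not a disjoint union of nonempty $J,K$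 with $a_{jk}=a_{kj}=0$ for $j\in J,k\in K$. Conditions (C1)–(C4): (C1) $a_{ii}\in\{0,2\}$; (C2) $a_{ii}=0\Rightarrow p(i)=1$; (C3) $a_{ii}=2\Rightarrow a_{ij}\in2^{p(i)}\mathbb Z_{\le0}$ for $j\neq i$; (C4) $a_{ij}=0$ and $a_{ji}\neq0$ $\Rightarrow a_{ii}=0$. Odd reflection: an index $k$ with $a_{kk}=0$, $p(k)=1$ is called isotropic; it is regular if for all $j\neq k$, $a_{kj}=0\Rightarrow a_{jk}=0$, and singular otherwise. The odd reflection at an isotropic $k$ produces $(A',p')$ defined, for $i,j\ne k$, by $a'_{kk}=a_{kk}$, $a'_{kj}=a_{kj}$, $a'_{ik}=-a_{ki}a_{ik}$, and $a'_{ij}=a_{ij}$ if $a_{ik}=a_{ki}=0$; $a'_{ij}=a_{ki}a_{ij}$ if ($a_{ik}\ne0$ or $a_{ki}\neq0$) and $a_{kj}=a_{jk}=0$; $a'_{ij}=a_{ki}a_{ij}+a_{kj}a_{ik}+a_{ki}a_{ik}$ if ($a_{ik}\ne0$ or $a_{ki}\ne 0$) and ($a_{jk}\ne0$ or $a_{kj}\ne0$); parities $p'(k)=1$, $p'(i)=p(i)+1$ if $a_{ik}\ne0$ or $a_{ki}\ne0$, and $p'(i)=p(i)$ otherwise; $A'$ is considered up to multiplying rows by nonzero scalars (normalized so that nonzero diagonal entries equal $2$). $A$ with $a_{ii}\in\{0,2\}$ is admissible if $A$ and every matrix obtained from $A$ by a finite sequence of odd reflections (regular or singular) satisfies (C1)–(C4).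 *)

theory Defs
  imports Complex_Main
begin

(* Index set I = {1..n}; matrices are functions nat => nat => complex, only entries
   with indices in {1..n} matter. Parity: p :: nat => bool, True = odd (1 in Z_2). *)

definition elemental :: "nat \<Rightarrow> (nat \<Rightarrow> nat \<Rightarrow> complex) \<Rightarrow> bool" where
  "elemental n A \<longleftrightarrow> (\<forall>i\<in>{1..n}. \<exists>j\<in>{1..n}. A i j \<noteq> 0)"

definition indecomposable :: "nat \<Rightarrow> (nat \<Rightarrow> nat \<Rightarrow> complex) \<Rightarrow> bool" where
  "indecomposable n A \<longleftrightarrow>
     \<not> (\<exists>J K. J \<union> K = {1..n} \<and> J \<inter> K = {} \<and> J \<noteq> {} \<and> K \<noteq> {} \<and>
            (\<forall>j\<in>J. \<forall>k\<in>K. A j k = 0 \<and> A k j = 0))"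

definition isotropic :: "nat \<Rightarrow> (nat \<Rightarrow> nat \<Rightarrow> complex) \<Rightarrow> (nat \<Rightarrow> bool) \<Rightarrow> nat \<Rightarrow> bool" where
  "isotropic n A p k \<longleftrightarrow> k \<in> {1..n} \<and> A k k = 0 \<and> p k"

definition singular_isotropic :: "nat \<Rightarrow> (nat \<Rightarrow> nat \<Rightarrow> complex) \<Rightarrow> (nat \<Rightarrow> bool) \<Rightarrow> nat \<Rightarrow> bool" where
  "singular_isotropic n A p k \<longleftrightarrow> isotropic n A p k \<and>
     (\<exists>j\<in>{1..n}. j \<noteq> k \<and> A k j = 0 \<and> A j k \<noteq> 0)"

definition cond_C1 :: "nat \<Rightarrow> (nat \<Rightarrow> nat \<Rightarrow> complex) \<Rightarrow> (nat \<Rightarrow> bool) \<Rightarrow> bool" where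
  "cond_C1 n A p \<longleftrightarrow> (\<forall>i\<in>{1..n}. A i i = 0 \<or> A i i = 2)"

definition cond_C2 :: "nat \<Rightarrow> (nat \<Rightarrow> nat \<Rightarrow> complex) \<Rightarrow> (nat \<Rightarrow> bool) \<Rightarrow> bool" where
  "cond_C2 n A p \<longleftrightarrow> (\<forall>i\<in>{1..n}. A i i = 0 \<longrightarrow> p i)"

definition cond_C3 :: "nat \<Rightarrow> (nat \<Rightarrow> nat \<Rightarrow> complex) \<Rightarrow> (nat \<Rightarrow> bool) \<Rightarrow> bool" where
  "cond_C3 n A p \<longleftrightarrow> (\<forall>i\<in>{1..n}. A i i = 2 \<longrightarrow>
      (\<forall>j\<in>{1..n}. j \<noteq> i \<longrightarrow>
         (\<exists>m::int. m \<le> 0 \<and> A i j = (if p i then 2 else 1) * of_int m)))"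

definition cond_C4 :: "nat \<Rightarrow> (nat \<Rightarrow> nat \<Rightarrow> complex) \<Rightarrow> (nat \<Rightarrow> bool) \<Rightarrow> bool" where
  "cond_C4 n A p \<longleftrightarrow> (\<forall>i\<in>{1..n}. \<forall>j\<in>{1..n}. A i j = 0 \<and> A j i \<noteq> 0 \<longrightarrow> A i i = 0)"

definition conds_C1_C4 :: "nat \<Rightarrow> (nat \<Rightarrow> nat \<Rightarrow> complex) \<Rightarrow> (nat \<Rightarrow> bool) \<Rightarrow> bool" where
  "conds_C1_C4 n A p \<longleftrightarrow> cond_C1 n A p \<and> cond_C2 n A p \<and> cond_C3 n A p \<and> cond_C4 n A p"

definition oddrefl_raw :: "(nat \<Rightarrow> nat \<Rightarrow> complex) \<Rightarrow> nat \<Rightarrow> nat \<Rightarrow> nat \<Rightarrow> complex" where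
  "oddrefl_raw A k i j =
     (if i = k then A k j
      else if j = k then - A k i * A i k
      else if A i k = 0 \<and> A k i = 0 then A i j
      else if A k j = 0 \<and> A j k = 0 then A k i * A i j
      else A k i * A i j + A k j * A i k + A k i * A i k)"

definition normalize_rows :: "(nat \<Rightarrow> nat \<Rightarrow> complex) \<Rightarrow> nat \<Rightarrow> nat \<Rightarrow> complex" where
  "normalize_rows A i j = (if A i i \<noteq> 0 then (2 / A i i) * A i j else A i j)"

definition oddrefl_mat :: "(nat \<Rightarrow> nat \<Rightarrow> complex) \<Rightarrow> nat \<Rightarrow> nat \<Rightarrow> nat \<Rightarrow> complex" where
  "oddrefl_mat A k = normalize_rows (oddrefl_raw A k)"

definition oddrefl_par :: "(nat \<Rightarrow> nat \<Rightarrow> complex) \<Rightarrow> (nat \<Rightarrow> bool) \<Rightarrow> nat \<Rightarrow> nat \<Rightarrow> bool" where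
  "oddrefl_par A p k i =
     (if i = k then True else if A i k \<noteq> 0 \<or> A k i \<noteq> 0 then \<not> p i else p i)"

inductive reachable_by_odd_refl ::
  "nat \<Rightarrow> (nat \<Rightarrow> nat \<Rightarrow> complex) \<Rightarrow> (nat \<Rightarrow> bool) \<Rightarrow> (nat \<Rightarrow> nat \<Rightarrow> complex) \<Rightarrow> (nat \<Rightarrow> bool) \<Rightarrow> bool"
  for n A p where
  refl: "reachable_by_odd_refl n A p A p"
| step: "reachable_by_odd_refl n A p B q \<Longrightarrow> isotropic n B q k \<Longrightarrow>
         reachable_by_odd_refl n A p (oddrefl_mat B k) (oddrefl_par B q k)"

definition admissible :: "nat \<Rightarrow> (nat \<Rightarrow> nat \<Rightarrow> complex) \<Rightarrow> (nat \<Rightarrow> bool) \<Rightarrow> bool" where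
  "admissible n A p \<longleftrightarrow> (\<forall>i\<in>{1..n}. A i i = 0 \<or> A i i = 2) \<and>
     (\<forall>B q. reachable_by_odd_refl n A p B q \<longrightarrow> conds_C1_C4 n B q)"

definition rows_independent :: "nat \<Rightarrow> (nat \<Rightarrow> nat \<Rightarrow> complex) \<Rightarrow> nat set \<Rightarrow> bool" where
  "rows_independent n A S \<longleftrightarrow>
     (\<forall>c::nat \<Rightarrow> complex. (\<forall>j\<in>{1..n}. (\<Sum>i\<in>S. c i * A i j) = 0) \<longrightarrow> (\<forall>i\<in>S. c i = 0))"

definition mat_rank :: "nat \<Rightarrow> (nat \<Rightarrow> nat \<Rightarrow> complex) \<Rightarrow> nat" where
  "mat_rank n A = Max {card S | S. S \<subseteq> {1..n} \<and> rows_independent n A S}"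

definition corank :: "nat \<Rightarrow> (nat \<Rightarrow> nat \<Rightarrow> complex) \<Rightarrow> nat" where
  "corank n A = n - mat_rank n A"

definition psign :: "bool \<Rightarrow> bool \<Rightarrow> complex" where
  "psign a b = (if a \<and> b then -1 else 1)"

text \<open>G False = even part, G True = odd part.\<close>
definition lie_superalgebra ::
  "(complex \<Rightarrow> 'v::ab_group_add \<Rightarrow> 'v) \<Rightarrow> ('v \<Rightarrow> 'v \<Rightarrow> 'v) \<Rightarrow> (bool \<Rightarrow> 'v set) \<Rightarrow> bool" where
  "lie_superalgebra S br G \<longleftrightarrow>
     vector_space S \<and>
     (\<forall>c x y z. br (S c x + y) z = S c (br x z) + br y z) \<and>
     (\<forall>c x y z. br z (S c x + y) = S c (br z x) + br z y) \<and>
     (\<forall>a. module.subspace S (G a)) \<and>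
     G False \<inter> G True = {0} \<and>
     (\<forall>v. \<exists>u w. u \<in> G False \<and> w \<in> G True \<and> v = u + w) \<and>
     (\<forall>a b x y. x \<in> G a \<longrightarrow> y \<in> G b \<longrightarrow> br x y \<in> G (a \<noteq> b)) \<and>
     (\<forall>a b x y. x \<in> G a \<longrightarrow> y \<in> G b \<longrightarrow> br x y = - S (psign a b) (br y x)) \<and>
     (\<forall>a b x y z. x \<in> G a \<longrightarrow> y \<in> G b \<longrightarrow>
         br x (br y z) = br (br x y) z + S (psign a b) (br y (br x z)))"

definition is_ideal :: "(complex \<Rightarrow> 'v::ab_group_add \<Rightarrow> 'v) \<Rightarrow> ('v \<Rightarrow> 'v \<Rightarrow> 'v) \<Rightarrow> 'v set \<Rightarrow> bool" where
  "is_ideal S br J \<longleftrightarrow> module.subspace S J \<and> (\<forall>x y. y \<in> J \<longrightarrow> br x y \<in> J)"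

text \<open>Realization of (A,p) as the contragredient Lie superalgebra g(A): Cartan subalgebra hs,
  simple roots al i (linear forms on hs), coroots hh i, generators X i, Y i.  The algebra is
  generated by hs and the X i, Y i, satisfies the defining relations of gbar(A), and has no
  nonzero ideal meeting hs trivially; this characterizes g(A) up to isomorphism.\<close>
definition is_contragredient ::
  "nat \<Rightarrow> (nat \<Rightarrow> nat \<Rightarrow> complex) \<Rightarrow> (nat \<Rightarrow> bool) \<Rightarrow>
   (complex \<Rightarrow> 'v::ab_group_add \<Rightarrow> 'v) \<Rightarrow> ('v \<Rightarrow> 'v \<Rightarrow> 'v) \<Rightarrow> (bool \<Rightarrow> 'v set) \<Rightarrow>
   'v set \<Rightarrow> (nat \<Rightarrow> 'v \<Rightarrow> complex) \<Rightarrow> (nat \<Rightarrow> 'v) \<Rightarrow> (nat \<Rightarrow> 'v) \<Rightarrow> (nat \<Rightarrow> 'v) \<Rightarrow> bool" where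
  "is_contragredient n A p S br G hs al hh X Y \<longleftrightarrow>
     lie_superalgebra S br G \<and>
     \<comment> \<open>hs: even abelian subspace of dimension n + corank A\<close>
     hs \<subseteq> G False \<and>
     (\<exists>B. finite B \<and> \<not> module.dependent S B \<and> module.span S B = hs \<and> card B = n + corank n A) \<and>
     (\<forall>x\<in>hs. \<forall>y\<in>hs. br x y = 0) \<and>
     \<comment> \<open>alpha_i linear forms on hs, linearly independent\<close>
     (\<forall>i\<in>{1..n}. \<forall>c. \<forall>x\<in>hs. \<forall>y\<in>hs. al i (S c x + y) = c * al i x + al i y) \<and>
     (\<forall>c::nat \<Rightarrow> complex. (\<forall>x\<in>hs. (\<Sum>i\<in>{1..n}. c i * al i x) = 0) \<longrightarrow> (\<forall>i\<in>{1..n}. c i = 0)) \<and>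
     \<comment> \<open>coroots\<close>
     (\<forall>i\<in>{1..n}. hh i \<in> hs) \<and>
     (\<forall>i\<in>{1..n}. \<forall>j\<in>{1..n}. al j (hh i) = A i j) \<and>
     \<comment> \<open>generators and relations\<close>
     (\<forall>i\<in>{1..n}. X i \<in> G (p i) \<and> Y i \<in> G (p i)) \<and>
     (\<forall>i\<in>{1..n}. \<forall>h\<in>hs. br h (X i) = S (al i h) (X i)) \<and>
     (\<forall>i\<in>{1..n}. \<forall>h\<in>hs. br h (Y i) = S (- al i h) (Y i)) \<and>
     (\<forall>i\<in>{1..n}. \<forall>j\<in>{1..n}. br (X i) (Y j) = (if i = j then hh i else 0)) \<and>
     \<comment> \<open>generated by hs, X, Y\<close>
     (\<forall>W. module.subspace S W \<and> (\<forall>x\<in>W. \<forall>y\<in>W. br x y \<in> W) \<and> hs \<subseteq> W \<and>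
          X ` {1..n} \<subseteq> W \<and> Y ` {1..n} \<subseteq> W \<longrightarrow> W = UNIV) \<and>
     \<comment> \<open>no nonzero ideal meeting hs trivially\<close>
     (\<forall>J. is_ideal S br J \<and> J \<inter> hs = {0} \<longrightarrow> J = {0})"

inductive principal_monomial ::
  "nat \<Rightarrow> ('v \<Rightarrow> 'v \<Rightarrow> 'v) \<Rightarrow> 'v set \<Rightarrow> (nat \<Rightarrow> 'v) \<Rightarrow> (nat \<Rightarrow> 'v) \<Rightarrow> int \<Rightarrow> 'v \<Rightarrow> bool"
  for n br hs X Y where
  cartan: "h \<in> hs \<Longrightarrow> principal_monomial n br hs X Y 0 h"
| genX: "i \<in> {1..n} \<Longrightarrow> principal_monomial n br hs X Y 1 (X i)"
| genY: "i \<in> {1..n} \<Longrightarrow> principal_monomial n br hs X Y (-1) (Y i)"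
| brk: "principal_monomial n br hs X Y m x \<Longrightarrow> principal_monomial n br hs X Y k y \<Longrightarrow>
        principal_monomial n br hs X Y (m + k) (br x y)"

definition principal_component ::
  "nat \<Rightarrow> (complex \<Rightarrow> 'v::ab_group_add \<Rightarrow> 'v) \<Rightarrow> ('v \<Rightarrow> 'v \<Rightarrow> 'v) \<Rightarrow> 'v set \<Rightarrow> (nat \<Rightarrow> 'v) \<Rightarrow> (nat \<Rightarrow> 'v) \<Rightarrow> int \<Rightarrow> 'v set" where
  "principal_component n S br hs X Y m = module.span S {x. principal_monomial n br hs X Y m x}"

definition finite_growth ::
  "nat \<Rightarrow> (complex \<Rightarrow> 'v::ab_group_add \<Rightarrow> 'v) \<Rightarrow> ('v \<Rightarrow> 'v \<Rightarrow> 'v) \<Rightarrow> 'v set \<Rightarrow> (nat \<Rightarrow> 'v) \<Rightarrow> (nat \<Rightarrow> 'v) \<Rightarrow> bool" where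
  "finite_growth n S br hs X Y \<longleftrightarrow>
     (\<exists>C d::nat. \<forall>m::int. \<exists>B. finite B \<and> card B \<le> C * (nat \<bar>m\<bar> + 1) ^ d \<and>
        principal_component n S br hs X Y m \<subseteq> module.span S B)"

definition contragredient_finite_growth ::
  "nat \<Rightarrow> (nat \<Rightarrow> nat \<Rightarrow> complex) \<Rightarrow> (nat \<Rightarrow> bool) \<Rightarrow> 'v::ab_group_add itself \<Rightarrow> bool" where
  "contragredient_finite_growth n A p (_ :: 'v itself) \<longleftrightarrow>
     (\<exists>(S :: complex \<Rightarrow> 'v \<Rightarrow> 'v) br G hs al hh X Y.
        is_contragredient n A p S br G hs al hh X Y \<and> finite_growth n S br hs X Y)"

definition S120_mat :: "nat \<Rightarrow> nat \<Rightarrow> complex" where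
  "S120_mat i j =
    (if i = 1 then (if j = 1 then 0 else if j = 2 then 0 else 1)
     else if i = 2 then (if j = 1 then -1 else if j = 2 then 2 else -1)
     else (if j = 1 then 1 else if j = 2 then -2 else 0))"

definition S120_par :: "nat \<Rightarrow> bool" where
  "S120_par i = (i = 1 \<or> i = 3)"

definition D210_mat :: "nat \<Rightarrow> nat \<Rightarrow> complex" where
  "D210_mat i j =
    (if i = 1 then (if j = 1 then 0 else if j = 2 then 0 else 1)
     else if i = 2 then (if j = 1 then -1 else if j = 2 then 2 else 0)
     else (if j = 1 then -1 else if j = 2 then 0 else 2))"

definition D210_par :: "nat \<Rightarrow> bool" where
  "D210_par i = (i = 1)"

definition equiv_reorder_rescale ::
  "nat \<Rightarrow> (nat \<Rightarrow> nat \<Rightarrow> complex) \<Rightarrow> (nat \<Rightarrow> bool) \<Rightarrow> (nat \<Rightarrow> nat \<Rightarrow> complex) \<Rightarrow> (nat \<Rightarrow> bool) \<Rightarrow> bool" where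
  "equiv_reorder_rescale n A p B q \<longleftrightarrow>
     (\<exists>\<sigma> c. bij_betw \<sigma> {1..n} {1..n} \<and> (\<forall>i\<in>{1..n}. c i \<noteq> (0::complex)) \<and>
        (\<forall>i\<in>{1..n}. \<forall>j\<in>{1..n}. c i * A (\<sigma> i) (\<sigma> j) = B i j) \<and>
        (\<forall>i\<in>{1..n}. p (\<sigma> i) = q i))"

end

theory Submission
  imports Defs "HOL-Library.Nat_Bijection"
begin

text \<open>
  Let \<open>k\<close> be singular, \<open>a\<^sub>k\<^sub>j = 0 \<noteq> a\<^sub>j\<^sub>k\<close>, and let \<open>l\<close> be the third index, so \<open>a\<^sub>k\<^sub>l \<noteq> 0\<close>.
  Conditions (C1)--(C4) for a few iterated odd reflections force \<open>S(1,2,0)\<close> if \<open>l\<close> is odd.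
  If \<open>l\<close> is even they force the shape of \<open>D(2,1,0)\<close>, except that \<open>a = - a\<^sub>j\<^sub>k\<close> remains an
  arbitrary positive integer: the reflection at \<open>k\<close> forgets \<open>a\<close>.

  For \<open>a \<ge> 2\<close> growth is infinite. The space spanned by \<open>X\<^sub>k\<close> under the two commuting even copies
  of sl(2) is \<open>W \<otimes> V\<close> with \<open>dim W = a + 1\<close> and \<open>dim V = 2\<close>, and its symmetric square contains
  \<open>\<Lambda>\<^sup>2 W \<otimes> \<Lambda>\<^sup>2 V\<close>, in which the \<open>j\<close>-th sl(2) generates a module of dimension \<open>2 a - 1 \<ge> 3\<close>
  from a lowest weight vector \<open>E\<close>. Its elements \<open>x\<^sub>i\<close> and their duals \<open>y\<^sub>i\<close> satisfy
  \<open>[x\<^sub>i, y\<^sub>j] = \<delta>\<^sub>i\<^sub>j c\<close> and \<open>[c, x\<^sub>i] = s x\<^sub>i\<close> with \<open>s \<noteq> 0\<close>. Then the brackets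
  \<open>[x\<^sub>i, [x\<^sub>i, x\<^sub>j]]\<close> with \<open>i \<noteq> j\<close> form a family of the same kind, so that \<open>r\<close> independent elements
  of degree at most \<open>D\<close> yield \<open>r (r - 1)\<close> independent elements of degree at most \<open>3 D\<close>;
  starting from \<open>r = 3\<close> this outgrows every polynomial.
\<close>

section \<open>Brackets in a Lie superalgebra\<close>

locale super_lie =
  fixes S :: "complex \<Rightarrow> 'v::ab_group_add \<Rightarrow> 'v" and br :: "'v \<Rightarrow> 'v \<Rightarrow> 'v" and G :: "bool \<Rightarrow> 'v set"
  assumes lsa: "lie_superalgebra S br G"

sublocale super_lie \<subseteq> vector_space S
  using lsa unfolding lie_superalgebra_def by (elim conjE)

context super_lie
begin

lemma br_comb_left: "br (S c x + y) z = S c (br x z) + br y z"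
  and br_comb_right: "br z (S c x + y) = S c (br z x) + br z y"
proof -
  have "\<forall>c x y z. br (S c x + y) z = S c (br x z) + br y z"
    using lsa unfolding lie_superalgebra_def by (elim conjE)
  then show "br (S c x + y) z = S c (br x z) + br y z" by (elim allE)
  have "\<forall>c x y z. br z (S c x + y) = S c (br z x) + br z y"
    using lsa unfolding lie_superalgebra_def by (elim conjE)
  then show "br z (S c x + y) = S c (br z x) + br z y" by (elim allE)
qed

lemma br_add_left: "br (x + y) z = br x z + br y z"
  using br_comb_left[of 1 x y z] by simp

lemma br_add_right: "br z (x + y) = br z x + br z y"
  using br_comb_right[of z 1 x y] by simp

lemma br_zero_left [simp]: "br 0 z = 0"
  using br_add_left[of 0 0 z] by simp

lemma br_zero_right [simp]: "br z 0 = 0"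
  using br_add_right[of z 0 0] by simp

lemma br_scale_left: "br (S c x) z = S c (br x z)"
  using br_comb_left[of c x 0] by simp

lemma br_scale_right: "br z (S c x) = S c (br z x)"
  using br_comb_right[of z c x 0] by simp

lemma br_minus_left: "br (- x) z = - br x z"
  using br_scale_left[of "-1" x z] by simp

lemma br_minus_right: "br z (- x) = - br z x"
  using br_scale_right[of z "-1" x] by simp

lemma br_diff_left: "br (x - y) z = br x z - br y z"
  using br_add_left[of x "- y" z] by (simp add: br_minus_left)

lemma br_diff_right: "br z (x - y) = br z x - br z y"
  using br_add_right[of z x "- y"] by (simp add: br_minus_right)

lemmas br_linear = br_add_left br_add_right br_diff_left br_diff_right
  br_minus_left br_minus_right br_scale_left br_scale_right

lemma parity_decomp: obtains u w where "u \<in> G False" "w \<in> G True" "v = u + w"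
proof -
  have "\<forall>v. \<exists>u w. u \<in> G False \<and> w \<in> G True \<and> v = u + w"
    using lsa unfolding lie_superalgebra_def by (elim conjE)
  then show ?thesis using that by blast
qed

lemma subspace_G: "subspace (G a)"
proof -
  have "\<forall>a. subspace (G a)"
    using lsa unfolding lie_superalgebra_def by (elim conjE)
  then show ?thesis by (elim allE)
qed

lemma br_parity:
  assumes "x \<in> G a" "y \<in> G b" shows "br x y \<in> G (a \<noteq> b)"
proof -
  have "\<forall>a b x y. x \<in> G a \<longrightarrow> y \<in> G b \<longrightarrow> br x y \<in> G (a \<noteq> b)"
    using lsa unfolding lie_superalgebra_def by (elim conjE)
  then show ?thesis using assms by (elim allE impE)
qed

lemma super_skew:
  assumes "x \<in> G a" "y \<in> G b" shows "br x y = - S (psign a b) (br y x)"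
proof -
  have "\<forall>a b x y. x \<in> G a \<longrightarrow> y \<in> G b \<longrightarrow> br x y = - S (psign a b) (br y x)"
    using lsa unfolding lie_superalgebra_def by (elim conjE)
  then show ?thesis using assms by (elim allE impE)
qed

lemma super_jacobi:
  assumes "x \<in> G a" "y \<in> G b"
  shows "br x (br y z) = br (br x y) z + S (psign a b) (br y (br x z))"
proof -
  have "\<forall>a b x y z. x \<in> G a \<longrightarrow> y \<in> G b \<longrightarrow>
          br x (br y z) = br (br x y) z + S (psign a b) (br y (br x z))"
    using lsa unfolding lie_superalgebra_def by (elim conjE)
  then show ?thesis using assms by (elim allE impE)
qed

lemma br_even_even: "x \<in> G False \<Longrightarrow> y \<in> G False \<Longrightarrow> br x y \<in> G False"
  and br_even_odd: "x \<in> G False \<Longrightarrow> y \<in> G True \<Longrightarrow> br x y \<in> G True"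
  and br_odd_odd: "x \<in> G True \<Longrightarrow> y \<in> G True \<Longrightarrow> br x y \<in> G False"
  using br_parity[of x False y False] br_parity[of x False y True] br_parity[of x True y True]
  by simp_all

text \<open>The axioms only speak of homogeneous arguments. If one argument is even, all signs are
  +1, so splitting the other into parities extends skewness, and likewise Jacobi below, to arbitrary
  elements.\<close>

lemma even_skew:
  assumes "x \<in> G False" shows "br x y = - br y x"
proof -
  obtain u w where uw: "u \<in> G False" "w \<in> G True" "y = u + w" by (rule parity_decomp)
  show ?thesis
    using super_skew[OF assms uw(1)] super_skew[OF assms uw(2)]
    by (simp add: uw(3) psign_def br_linear)
qed

lemma even_jacobi:
  assumes "x \<in> G False" shows "br x (br y z) = br (br x y) z + br y (br x z)"
proof -
  obtain u w where uw: "u \<in> G False" "w \<in> G True" "y = u + w" by (rule parity_decomp)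
  show ?thesis
    using super_jacobi[OF assms uw(1), of z] super_jacobi[OF assms uw(2), of z]
    by (simp add: uw(3) psign_def br_linear)
qed

lemma odd_sym: "u \<in> G True \<Longrightarrow> v \<in> G True \<Longrightarrow> br u v = br v u"
  using super_skew[of u True v True] by (simp add: psign_def)

lemma odd_jacobi:
  "u \<in> G True \<Longrightarrow> v \<in> G True \<Longrightarrow> br u (br v z) = br (br u v) z - br v (br u z)"
  using super_jacobi[of u True v True z] by (simp add: psign_def)

lemma even_eigen_br:
  assumes "c \<in> G False" "br c u = S a u" "br c v = S b v"
  shows "br c (br u v) = S (a + b) (br u v)"
  using assms by (simp add: even_jacobi[OF assms(1)] br_linear scale_left_distrib)

section \<open>Dual families and their triple brackets\<close>

text \<open>These are the relations of Chevalley generators for the matrix all of whose entries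
  equal \<open>s\<close>, with every coroot identified with the single element
  \<open>c\<close>.\<close>

definition dual_family ::
    "'v \<Rightarrow> complex \<Rightarrow> 'i set \<Rightarrow> ('i \<Rightarrow> 'v) \<Rightarrow> ('i \<Rightarrow> 'v) \<Rightarrow> bool" where
  "dual_family c s I x y \<longleftrightarrow> c \<in> G False \<and> c \<noteq> 0 \<and> s \<noteq> 0 \<and>
     (\<forall>i\<in>I. x i \<in> G False \<and> y i \<in> G False \<and> br c (x i) = S s (x i) \<and> br c (y i) = S (- s) (y i)) \<and>
     (\<forall>i\<in>I. \<forall>j\<in>I. br (x i) (y j) = (if i = j then c else 0))"

lemma dual_family_reindex:
  assumes "dual_family c s I x y" "inj_on f J" "f ` J \<subseteq> I"
  shows "dual_family c s J (x \<circ> f) (y \<circ> f)"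
proof -
  have I: "f i \<in> I" if "i \<in> J" for i using assms(3) that by blast
  have inj: "f i = f j \<longleftrightarrow> i = j" if "i \<in> J" "j \<in> J" for i j
    using assms(2) that by (simp add: inj_on_eq_iff)
  show ?thesis using assms(1) by (simp add: dual_family_def I inj)
qed

text \<open>Each \<open>y k\<close> acts on products of the \<open>x i\<close> as a lowering
  operator, and the triple brackets pair diagonally with value \<open>9 * s\<^sup>2\<close>, which
  the scalar on the dual side removes. Triple brackets are used because three elements have only
  three brackets \<open>br (x i) (x j)\<close> up to sign, but six of the form
  \<open>br (x i) (br (x i) (x j))\<close>.\<close>

lemma dual_family_step:
  assumes df: "dual_family c s I x y"
  shows "dual_family c (3 * s) {(i, j). i \<in> I \<and> j \<in> I \<and> i \<noteq> j}
           (\<lambda>(i, j). br (x i) (br (x i) (x j)))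
           (\<lambda>(i, j). S (1 / (9 * s\<^sup>2)) (br (y i) (br (y i) (y j))))"
proof -
  have c: "c \<in> G False" "c \<noteq> 0" "s \<noteq> 0" using df by (auto simp: dual_family_def)
  have ev: "x i \<in> G False" "y i \<in> G False" if "i \<in> I" for i using df that by (auto simp: dual_family_def)
  have cx: "br c (x i) = S s (x i)" "br c (y i) = S (- s) (y i)" if "i \<in> I" for i
    using df that by (auto simp: dual_family_def)
  have yx: "br (y j) (x i) = (if i = j then - c else 0)" if "i \<in> I" "j \<in> I" for i j
    using df that even_skew[OF ev(2), of j "x i"] by (auto simp: dual_family_def)
  have xc: "br (x i) c = - S s (x i)" if "i \<in> I" for i
    using even_skew[OF c(1), of "x i"] cx(1)[OF that] by (metis minus_minus)
  have cxx: "br c (br (x i) (x j)) = S (2 * s) (br (x i) (x j))"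
    and cyy: "br c (br (y i) (y j)) = S (- 2 * s) (br (y i) (y j))" if "i \<in> I" "j \<in> I" for i j
    using even_eigen_br[OF c(1) cx(1) cx(1), of i j] even_eigen_br[OF c(1) cx(2) cx(2), of i j] that
    by simp_all
  have cX: "br c (br (x i) (br (x i) (x j))) = S (3 * s) (br (x i) (br (x i) (x j)))"
    and cY: "br c (br (y i) (br (y i) (y j))) = S (- 3 * s) (br (y i) (br (y i) (y j)))"
    if "i \<in> I" "j \<in> I" for i j
    using even_eigen_br[OF c(1) cx(1) cxx, of i i j] even_eigen_br[OF c(1) cx(2) cyy, of i i j] that
    by simp_all
  have y1: "br (y k) (br (x i) (x j)) = (if k = i then - S s (x j) else 0) + (if k = j then S s (x i) else 0)"
    if "i \<in> I" "j \<in> I" "k \<in> I" for i j k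
    using that by (auto simp: even_jacobi[OF ev(2)] yx xc cx br_linear)
  have y2: "br (y k) (br (x i) (br (x i) (x j))) = (if k = i then S (- 3 * s) (br (x i) (x j)) else 0)"
    if "i \<in> I" "j \<in> I" "k \<in> I" "i \<noteq> j" for i j k
  proof -
    have xx: "br (x i) (x i) = 0" 
      using yx cx(1)[OF that(1)] even_skew[OF ev(1)[OF that(1)], of "x i"]
      by (metis add_eq_0_iff local.scale_left_distrib local.scale_one
          local.scale_eq_0_iff one_add_one zero_neq_numeral)
    show ?thesis
      using that scale_left_distrib[of "-s" "-2 * s" "br (x i) (x j)"]
      by (auto simp: even_jacobi[OF ev(2), of _ "x i" "br (x i) (x j)"] yx y1 cxx br_linear xx)
  qed
  have xy: "br (br (x i) (br (x i) (x j))) (br (y k) (br (y k) (y l))) = (if k = i \<and> l = j then S (9 * s\<^sup>2) c else 0)"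
    if "i \<in> I" "j \<in> I" "k \<in> I" "l \<in> I" "i \<noteq> j" "k \<noteq> l" for i j k l
  proof -
    let ?X = "br (x i) (br (x i) (x j))"
    have X: "?X \<in> G False" using that by (intro br_even_even ev)
    have br1: "br (br (y k) (y l)) v = br (y k) (br (y l) v) - br (y l) (br (y k) v)" for v
      using even_jacobi[OF ev(2)[OF that(3)], of "y l" v] by simp
    have br2: "br (br (y k) (br (y k) (y l))) v = br (y k) (br (br (y k) (y l)) v) - br (br (y k) (y l)) (br (y k) v)" for v
      using even_jacobi[OF ev(2)[OF that(3)], of "br (y k) (y l)" v] by simp
    \<comment> \<open>With y for the adjoint action, the left factor acts as y_k y_k y_l - 2 y_k y_l
      y_k + y_l y_k y_k. On the diagonal the middle term contributes 6 and the last one 3 to the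
      coefficient 9.\<close>
    have "br (br (y k) (br (y k) (y l))) ?X = - (if k = i \<and> l = j then S (9 * s\<^sup>2) c else 0)"
      using that scale_left_distrib[of "6 * s\<^sup>2" "3 * s\<^sup>2" c]
        scale_left_distrib[of "3 * s\<^sup>2" "3 * s\<^sup>2" c]
      by (auto simp: br2 br1 y1 y2 br_linear yx power2_eq_square algebra_simps)
    then show ?thesis
      unfolding even_skew[OF X, of "br (y k) (br (y k) (y l))"] by simp
  qed
  have norm: "S (1 / (9 * s\<^sup>2)) (S (9 * s\<^sup>2) c) = c" using c(3) by simp
  let ?J = "{(i, j). i \<in> I \<and> j \<in> I \<and> i \<noteq> j}"
  let ?x = "\<lambda>(i, j). br (x i) (br (x i) (x j))"
  let ?y = "\<lambda>(i, j). S (1 / (9 * s\<^sup>2)) (br (y i) (br (y i) (y j)))"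
  have 1: "?x a \<in> G False \<and> ?y a \<in> G False \<and> br c (?x a) = S (3 * s) (?x a) \<and> br c (?y a) = S (- (3 * s)) (?y a)"
    if aJ: "a \<in> ?J" for a
  proof -
    obtain i j where a: "a = (i, j)" "i \<in> I" "j \<in> I" using aJ by auto
    show ?thesis
      by (simp add: a cX cY br_scale_right br_even_even ev subspace_scale[OF subspace_G])
  qed
  have 2: "br (?x a) (?y b) = (if a = b then c else 0)" if ab: "a \<in> ?J" "b \<in> ?J" for a b
  proof -
    obtain i j where a: "a = (i, j)" "i \<in> I" "j \<in> I" "i \<noteq> j" using ab by auto
    obtain k l where b: "b = (k, l)" "k \<in> I" "l \<in> I" "k \<noteq> l" using ab by auto
    show ?thesis
      by (simp only: a b prod.case br_scale_right xy[OF a(2,3) b(2,3) a(4) b(4)]) (use norm in auto)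
  qed
  show ?thesis
    unfolding dual_family_def by (intro conjI ballI c) (use c 1 2 in simp_all)
qed

end

section \<open>Dual families and growth\<close>

context super_lie
begin

text \<open>Bracketing a vanishing linear combination with \<open>y j\<close> leaves the j-th
  coefficient times \<open>c\<close>, and \<open>c\<close> is nonzero.\<close>

lemma dual_family_independent:
  assumes df: "dual_family c s I x y" and fin: "finite I"
  shows "inj_on x I" "independent (x ` I)"
proof -
  have c: "c \<noteq> 0" using df by (simp add: dual_family_def)
  have xy: "br (x i) (y j) = (if i = j then c else 0)" if "i \<in> I" "j \<in> I" for i j
    using df that by (simp add: dual_family_def)
  show inj: "inj_on x I"
    using xy c by (intro inj_onI) metis
  have sum_br: "br (sum f J) v = (\<Sum>i\<in>J. br (f i) v)" for f :: "'a \<Rightarrow> 'v" and J v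
    by (induction J rule: infinite_finite_induct) (simp_all add: br_add_left)
  show "independent (x ` I)"
  proof (rule independent_if_scalars_zero)
    show "finite (x ` I)" using fin by simp
    fix f v assume f: "(\<Sum>v\<in>x ` I. S (f v) v) = 0" and "v \<in> x ` I"
    then obtain j where j: "j \<in> I" "v = x j" by blast
    have "0 = br (\<Sum>i\<in>I. S (f (x i)) (x i)) (y j)"
      using f by (simp add: sum.reindex[OF inj])
    also have "\<dots> = (\<Sum>i\<in>I. if i = j then S (f (x j)) c else 0)"
      unfolding sum_br using j(1) by (intro sum.cong) (auto simp: br_scale_left xy)
    finally show "f v = 0" using j fin c by simp
  qed
qed

lemma br_principal_component:
  assumes "u \<in> principal_component n S br hs X Y a" "v \<in> principal_component n S br hs X Y b"
  shows "br u v \<in> principal_component n S br hs X Y (a + b)"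
proof -
  let ?M = "\<lambda>m. {x. principal_monomial n br hs X Y m x}"
  have sub: "subspace {u. br u v \<in> span W}" "subspace {u. br v u \<in> span W}" for v W
    by (rule subspaceI; simp add: br_linear span_zero span_add span_scale)+
  have 1: "br u w \<in> span (?M (a + b))" if "w \<in> ?M b" for w
    using assms(1) unfolding principal_component_def
    by (rule span_induct[OF _ sub(1)]) (use that in \<open>auto intro: span_base principal_monomial.brk\<close>)
  show ?thesis
    using assms(2) unfolding principal_component_def
    by (rule span_induct[OF _ sub(2)]) (use 1 in auto)
qed

text \<open>The number of elements of a dual family is roughly squared by
  \<open>dual_family_step\<close> while the degrees are only tripled.\<close>
lemma dual_family_iterate:
  assumes "dual_family c s (I :: nat set) x y" "finite I" "card I \<ge> 3"
    and "\<And>i. i \<in> I \<Longrightarrow> \<exists>m. m \<le> D \<and> x i \<in> principal_component n S br hs X Y (int m)"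
  shows "\<exists>s (I :: nat set) x y. dual_family c s I x y \<and> finite I \<and> 2 * card I \<ge> 3 * 2 ^ 2 ^ k \<and>
           (\<forall>i\<in>I. \<exists>m \<le> 3 ^ k * D. x i \<in> principal_component n S br hs X Y (int m))"
proof (induction k)
  case 0
  show ?case using assms by (intro exI[of _ s] exI[of _ I] exI[of _ x] exI[of _ y]) auto
next
  case (Suc k)
  then obtain s and I :: "nat set" and x y where IH: "dual_family c s I x y" "finite I" "2 * card I \<ge> 3 * 2 ^ 2 ^ k"
    and deg: "\<And>i. i \<in> I \<Longrightarrow> \<exists>m \<le> 3 ^ k * D. x i \<in> principal_component n S br hs X Y (int m)"
    by blast
  let ?J = "{(i, j). i \<in> I \<and> j \<in> I \<and> i \<noteq> j}"
  let ?x = "\<lambda>(i, j). br (x i) (br (x i) (x j))"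
  let ?y = "\<lambda>(i, j). S (1 / (9 * s\<^sup>2)) (br (y i) (br (y i) (y j)))"
  \<comment> \<open>Pairs are coded as numbers, so that the index type stays the same throughout the
    induction.\<close>
  let ?I = "prod_encode ` ?J"
  have J: "?J = I \<times> I - (\<lambda>i. (i, i)) ` I" by auto
  have fin: "finite ?J" unfolding J using IH(2) by simp
  have "card ?J = card I * card I - card I"
    unfolding J using IH(2)
    by (subst card_Diff_subset) (auto simp: card_cartesian_product card_image inj_on_def)
  then have card: "card ?I = card I * card I - card I"
    by (simp add: card_image inj_on_def prod_encode_eq)
  have "dual_family c (3 * s) ?I (?x \<circ> prod_decode) (?y \<circ> prod_decode)"
    by (rule dual_family_reindex[OF dual_family_step[OF IH(1)]])
       (auto simp: inj_on_def)
  moreover have "2 * card ?I \<ge> 3 * 2 ^ 2 ^ Suc k"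
  proof -
    \<comment> \<open>The invariant r >= 3N/2 is tight at the start, where r = 3 and N = 2. The
      factor 3/2 pays for the r lost diagonal pairs: 9/4 N^2 - 3/2 N >= 3/2 N^2 as soon as N >=
      2.\<close>
    define N :: nat where "N = 2 ^ 2 ^ k"
    have N: "2 ^ 2 ^ Suc k = N * N" by (simp add: N_def mult_2 power_add)
    have "(2::nat) ^ 1 \<le> 2 ^ 2 ^ k" by (intro power_increasing) auto
    then have N2: "N \<ge> 2" by (simp add: N_def)
    have r: "2 * card I \<ge> 3 * N" using IH(3) by (simp add: N_def)
    define r where "r = card I"
    have "3 * (N * N) + 2 * r \<le> 2 * (r * r)"
    proof -
      have "3 * N * (3 * N - 2) \<le> 2 * r * (2 * r - 2)"
        using r by (intro mult_le_mono[of "3 * N" "2 * r"] diff_le_mono) (simp_all add: r_def)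
      moreover have "3 * N * (3 * N - 2) = 9 * (N * N) - 6 * N"
        by (simp add: diff_mult_distrib2)
      moreover have "2 * r * (2 * r - 2) = 4 * (r * r) - 4 * r"
        by (simp add: diff_mult_distrib2)
      moreover have "r \<le> r * r" by (cases r) auto
      moreover have "2 * N \<le> N * N" using N2 by simp
      ultimately show ?thesis by linarith
    qed
    then show ?thesis unfolding card N r_def by linarith
  qed
  moreover have "\<exists>m \<le> 3 ^ Suc k * D. (?x \<circ> prod_decode) a \<in> principal_component n S br hs X Y (int m)" if "a \<in> ?I" for a
  proof -
    from that obtain i j where a: "a = prod_encode (i, j)" "i \<in> I" "j \<in> I" by auto
    obtain m m' where m: "m \<le> 3 ^ k * D" "x i \<in> principal_component n S br hs X Y (int m)"
      "m' \<le> 3 ^ k * D" "x j \<in> principal_component n S br hs X Y (int m')"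
      using deg a by blast
    have "br (x i) (br (x i) (x j)) \<in> principal_component n S br hs X Y (int m + (int m + int m'))"
      by (intro br_principal_component m)
    then show ?thesis
      using m a by (intro exI[of _ "m + (m + m')"]) auto
  qed
  ultimately show ?case
    using fin by (intro exI[of _ "3 * s"] exI[of _ ?I] exI[of _ "?x \<circ> prod_decode"] exI[of _ "?y \<circ> prod_decode"]
        conjI ballI finite_imageI)
qed

text \<open>After \<open>k\<close> iterations more than 2^(2^k) independent elements lie in degrees
  up to 3^k D. Under polynomial growth these degrees together have dimension only singly exponential
  in \<open>k\<close>.\<close>

lemma dual_family_not_finite_growth:
  assumes "dual_family c s (I :: nat set) x y" "finite I" "card I \<ge> 3"
    and "\<And>i. i \<in> I \<Longrightarrow> \<exists>m. m \<le> D \<and> x i \<in> principal_component n S br hs X Y (int m)"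
  shows "\<not> finite_growth n S br hs X Y"
proof
  assume "finite_growth n S br hs X Y"
  then obtain C d :: nat where "\<forall>m::int. \<exists>B. finite B \<and> card B \<le> C * (nat \<bar>m\<bar> + 1) ^ d \<and>
        principal_component n S br hs X Y m \<subseteq> span B"
    unfolding finite_growth_def by blast
  then obtain B where B: "\<And>m. finite (B m)" "\<And>m. card (B m) \<le> C * (nat \<bar>m\<bar> + 1) ^ d"
    "\<And>m. principal_component n S br hs X Y m \<subseteq> span (B m)"
    by metis
  \<comment> \<open>\<open>K\<close> collects the factors independent of \<open>k\<close>. The
    estimate ends in powers of two through K <= 2^K and 3 <= 4; the choice of \<open>k\<close> then
    gives K + 2k(d + 1) <= k^2, and k >= 4 gives k^2 <= 2^k.\<close>
  define K where "K = C * (D + 1) ^ (d + 1)"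
  define k where "k = 2 * (d + 1) + K + 4"
  obtain s' and I' :: "nat set" and x' y' where df: "dual_family c s' I' x' y'" "finite I'" "2 * card I' \<ge> 3 * 2 ^ 2 ^ k"
    and deg: "\<And>i. i \<in> I' \<Longrightarrow> \<exists>m \<le> 3 ^ k * D. x' i \<in> principal_component n S br hs X Y (int m)"
    using dual_family_iterate[OF assms, of k] by blast
  define T where "T = 3 ^ k * D"
  let ?B = "\<Union>m\<in>{..T}. B (int m)"
  have "x' ` I' \<subseteq> span ?B"
  proof
    fix v assume "v \<in> x' ` I'"
    then obtain m where "m \<le> T" "v \<in> principal_component n S br hs X Y (int m)"
      using deg T_def by blast
    then show "v \<in> span ?B"
      using B(3)[of "int m"] span_mono[of "B (int m)" ?B] by auto
  qed
  then have "card (x' ` I') \<le> card ?B"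
    using independent_span_bound[of ?B "x' ` I'"] dual_family_independent(2)[OF df(1,2)] B(1) by auto
  also have "card ?B \<le> (\<Sum>m\<in>{..T}. card (B (int m)))"
    by (rule card_UN_le) simp
  also have "\<dots> \<le> (\<Sum>m\<in>{..T}. C * (T + 1) ^ d)"
  proof (intro sum_mono)
    fix m assume "m \<in> {..T}"
    then have "C * (nat \<bar>int m\<bar> + 1) ^ d \<le> C * (T + 1) ^ d"
      by (intro mult_left_mono power_mono) auto
    then show "card (B (int m)) \<le> C * (T + 1) ^ d" using B(2)[of "int m"] by linarith
  qed
  also have "\<dots> = C * (T + 1) ^ (d + 1)" by (simp add: algebra_simps)
  also have "\<dots> \<le> C * (3 ^ k * (D + 1)) ^ (d + 1)"
    by (intro mult_left_mono power_mono) (auto simp: T_def)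
  also have "\<dots> = K * 3 ^ (k * (d + 1))"
    by (simp only: power_mult_distrib K_def power_mult mult.assoc mult.commute mult.left_commute)
  also have "\<dots> \<le> 2 ^ K * 4 ^ (k * (d + 1))"
    by (intro mult_mono power_mono) (auto simp: less_imp_le)
  also have "\<dots> = 2 ^ (K + k * (2 * (d + 1)))"
    by (simp add: power_add power_mult mult.commute[of k] flip: power_mult[of 2 2, simplified])
  also have "\<dots> \<le> 2 ^ 2 ^ k"
  proof (intro power_increasing)
    have "K + k * (2 * (d + 1)) \<le> k * k"
    proof -
      have "K \<le> k * K" by (simp add: k_def)
      moreover have "k * k = k * (2 * (d + 1)) + k * K + k * 4"
        by (subst (2) k_def) (simp add: algebra_simps)
      ultimately show ?thesis by linarith
    qed
    also have "k * k \<le> 2 ^ k"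
    proof -
      have "k \<ge> 4" by (simp add: k_def)
      then show ?thesis
      proof (induction k rule: dec_induct)
        case (step m)
        have "2 * m + 1 \<le> m * m" using mult_le_mono1[OF step(1), of m] step(1) by linarith
        then show ?case using step(3) by simp
      qed simp
    qed
    finally show "K + k * (2 * (d + 1)) \<le> 2 ^ k" .
  qed simp
  finally have "card (x' ` I') \<le> 2 ^ 2 ^ k" .
  moreover have "card (x' ` I') = card I'"
    by (rule card_image[OF dual_family_independent(1)[OF df(1,2)]])
  moreover have "(0::nat) < 2 ^ 2 ^ k" by simp
  ultimately show False using df(3) by linarith
qed

section \<open>A dual family with three members from sl(2) theory\<close>

text \<open>\<open>E\<close> is annihilated by \<open>Y\<close> and \<open>F\<close> by
  \<open>X\<close>, while \<open>c\<close> commutes with both. Moving \<open>X\<close> across the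
  bracket therefore turns the pairing of X^i E with Y^j F into (-1)^i times that of \<open>E\<close>
  with X^i Y^j F. This vanishes off the diagonal; on it the values are 1, -\<mu> and 2 \<mu> (\<mu>
  - 1) times \<open>c\<close>, which the scalars invert.\<close>

lemma sl2_dual_family:
  assumes even: "X \<in> G False" "Y \<in> G False" "h \<in> G False" "E \<in> G False" "F \<in> G False" "c \<in> G False"
    and sl2: "br X Y = h" "br h Y = S (-2) Y"
    and ext: "br X F = 0" "br Y E = 0" "br h F = S \<mu> F" "br E F = c"
    and c: "br c X = 0" "br c Y = 0" "br c E = S s E" "br c F = S (- s) F" "c \<noteq> 0"
    and nz: "s \<noteq> 0" "\<mu> \<noteq> 0" "\<mu> \<noteq> 1"
  shows "dual_family c s {..<3::nat} (\<lambda>i. (br X ^^ i) E)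
           (\<lambda>i. S (if i = 0 then 1 else if i = 1 then - 1 / \<mu> else 1 / (2 * \<mu> * (\<mu> - 1))) ((br Y ^^ i) F))"
proof -
  let ?e1 = "br X E" and ?f1 = "br Y F"
  let ?e2 = "br X ?e1" and ?f2 = "br Y ?f1"
  have skew: "br X c = 0" "br Y c = 0" "br E Y = 0"
    using even_skew[OF even(1), of c] even_skew[OF even(2), of c] even_skew[OF even(4), of Y] c(1,2) ext(2)
    by simp_all
  note eX = even_jacobi[OF even(1)] and eY = even_jacobi[OF even(2)]
  have ad_X: "br (br X u) v = br X (br u v) - br u (br X v)" for u v
    using eX[of u v] by simp
  have Xf1: "br X ?f1 = S \<mu> F" by (simp add: eX[of Y F] sl2 ext)
  have hf1: "br h ?f1 = S (\<mu> - 2) ?f1"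
    using even_eigen_br[OF even(3) sl2(2) ext(3)] by (simp add: algebra_simps)
  have Xf2: "br X ?f2 = S (2 * \<mu> - 2) ?f1"
  proof -
    have "br X ?f2 = S (\<mu> - 2) ?f1 + S \<mu> ?f1" by (simp add: eX[of Y ?f1] sl2 hf1 Xf1 br_scale_right)
    also have "\<dots> = S (2 * \<mu> - 2) ?f1" by (simp add: algebra_simps flip: scale_left_distrib)
    finally show ?thesis .
  qed
  have E: "br E ?f1 = 0" "br E ?f2 = 0"
    by (simp_all add: even_jacobi[OF even(4)] skew ext)
  have e1: "br ?e1 F = 0" "br ?e1 ?f1 = S (- \<mu>) c" "br ?e1 ?f2 = 0"
    by (simp_all add: ad_X ext skew Xf1 Xf2 E br_scale_right)
  have e2: "br ?e2 F = 0" "br ?e2 ?f1 = 0" "br ?e2 ?f2 = S (2 * \<mu> * (\<mu> - 1)) c"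
    by (simp_all add: ad_X[of ?e1] ext skew Xf1 Xf2 e1 br_linear algebra_simps)
  have cx: "br c ?e1 = S s ?e1" "br c ?f1 = S (- s) ?f1" 
    using even_eigen_br[OF even(6), of X 0 E s] even_eigen_br[OF even(6), of Y 0 F "- s"] c by simp_all
  have cx2: "br c ?e2 = S s ?e2" "br c ?f2 = S (- s) ?f2" 
    using even_eigen_br[OF even(6), of X 0 ?e1 s] even_eigen_br[OF even(6), of Y 0 ?f1 "- s"] c cx by simp_all
  define \<nu> where "\<nu> = 2 * \<mu> * (\<mu> - 1)"
  have \<nu>: "\<nu> \<noteq> 0" "br ?e2 ?f2 = S \<nu> c" using nz e2(3) by (simp_all add: \<nu>_def)
  have I: "{..<3::nat} = {0, 1, 2}" by auto
  show ?thesis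
    unfolding dual_family_def I \<nu>_def[symmetric]
    using nz c even \<nu> by (simp add: numeral_2_eq_2 br_even_even subspace_scale[OF subspace_G]
        subspace_neg[OF subspace_G] br_linear cx cx2 E e1 e2(1,2) ext mult.commute)
qed

text \<open>Since \<open>[X1, X1] = 0\<close> is not assumed, \<open>E\<close> and \<open>F\<close> are antisymmetrized; either summand alone
  would satisfy \<open>br Y2 E = 0\<close>, \<open>br X2 F = 0\<close> only modulo \<open>[X1, X1]\<close>, \<open>[Y1, Y1]\<close>.\<close>
lemma skew_square_bracket:
  assumes odd: "X1 \<in> G True" "Y1 \<in> G True"
    and even: "X2 \<in> G False" "Y2 \<in> G False" "X3 \<in> G False" "Y3 \<in> G False"
      "h1 \<in> G False" "h2 \<in> G False" "h3 \<in> G False"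
    and gen: "br X1 Y1 = h1" "br X2 Y2 = h2" "br X3 Y3 = h3" "br X1 Y2 = 0" "br X1 Y3 = 0"
      "br X2 Y1 = 0" "br X2 Y3 = 0" "br X3 Y1 = 0" "br X3 Y2 = 0"
    and h1: "br h1 X1 = 0" "br h1 Y1 = 0" "br h1 X2 = 0" "br h1 Y2 = 0" "br h1 X3 = S t X3" "br h1 Y3 = S (- t) Y3"
    and h2: "br h2 X1 = S (- a) X1" "br h2 Y1 = S a Y1" "br h2 X3 = 0" "br h2 Y3 = 0"
    and h3: "br h3 X1 = - X1" "br h3 Y1 = Y1" "br h3 X2 = 0" "br h3 Y2 = 0"
    and w: "w = br X2 X1" "w' = br Y2 Y1"
    and z: "z0 = br X3 X1" "z1 = br X3 w" "z0' = br Y3 Y1" "z1' = br Y3 w'"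
    and EF: "E = br X1 z1 - br w z0" "F = br Y1 z1' - br w' z0'"
  shows "br E F = S (- 4 * a * t) (S 2 h1 - S t h3)" "br X2 F = 0" "br Y2 E = 0"
    "E \<in> G False" "F \<in> G False"
proof -
  note eX2 = even_jacobi[OF even(1)] and eY2 = even_jacobi[OF even(2)]
    and eX3 = even_jacobi[OF even(3)] and eY3 = even_jacobi[OF even(4)]
  have oddw: "w \<in> G True" "w' \<in> G True" unfolding w by (intro br_even_odd even odd)+
  have oddz: "z0 \<in> G True" "z0' \<in> G True" "z1 \<in> G True" "z1' \<in> G True"
    unfolding z by (intro br_even_odd even odd oddw)+
  show "E \<in> G False" "F \<in> G False"
    unfolding EF by (intro subspace_diff[OF subspace_G] br_odd_odd odd oddw oddz)+
  have ad_X2: "br (br X2 u) v = br X2 (br u v) - br u (br X2 v)" for u v using eX2[of u v] by simp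
  have ad_X3: "br (br X3 u) v = br X3 (br u v) - br u (br X3 v)" for u v using eX3[of u v] by simp
  have ad_Y2: "br (br Y2 u) v = br Y2 (br u v) - br u (br Y2 v)" for u v using eY2[of u v] by simp
  have ad_Y3: "br (br Y3 u) v = br Y3 (br u v) - br u (br Y3 v)" for u v using eY3[of u v] by simp
  have yx: "br Y2 X1 = 0" "br Y3 X1 = 0" "br Y3 X2 = 0" "br Y2 X3 = 0" "br Y2 X2 = - h2" "br Y3 X3 = - h3"
    using even_skew[OF even(2), of X1] even_skew[OF even(4), of X1] even_skew[OF even(4), of X2]
      even_skew[OF even(2), of X3] even_skew[OF even(2), of X2] even_skew[OF even(4), of X3] gen by simp_all
  have yh: "br X2 h1 = 0" "br Y2 h1 = 0" "br X3 h1 = S (- t) X3" "br Y3 h1 = S t Y3" "br X2 h3 = 0"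
    using even_skew[OF even(1), of h1] even_skew[OF even(2), of h1] even_skew[OF even(3), of h1]
      even_skew[OF even(4), of h1] even_skew[OF even(1), of h3] h1 h3 by simp_all
  have hw: "br h1 w = 0" "br h3 w = - w" "br h3 w' = w'" "br h1 w' = 0"
    unfolding w by (simp_all add: even_jacobi[OF even(5)] even_jacobi[OF even(7)] h1 h3 br_linear)
  have Yw: "br Y2 w = S a X1" "br Y3 w = 0"  "br X2 w' = S a Y1" "br X3 w' = 0"
    unfolding w by (simp_all add: eY2[of X2] eY3[of X2] eX2[of Y2] eX3[of Y2] yx gen h2 br_linear)
  have Yz: "br Y2 z0 = 0" "br Y2 z1 = S a z0" "br X2 z0' = 0" "br X2 z1' = S a z0'"
    unfolding z by (simp_all add: eY2[of X3] eX2[of Y3] yx gen Yw br_linear)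
  \<comment> \<open>\<open>E\<close> is the determinant of the array with rows \<open>X1\<close>,
    \<open>w\<close> and \<open>z0\<close>, \<open>z1\<close>. \<open>Y2\<close> kills the first
    column and sends the second to \<open>a\<close> times the first, so the two terms cancel. The
    same holds for \<open>X2\<close> and \<open>F\<close>.\<close>
  show "br X2 F = 0" unfolding EF by (simp add: br_linear eX2 gen Yw Yz)
  show "br Y2 E = 0" unfolding EF by (simp add: br_linear eY2 yx Yw Yz)
  have Y3z: "br Y3 z0 = X1" "br Y3 z1 = w"
    unfolding z by (simp_all add: eY3[of X3] yx h3 hw Yw br_linear)
  have X3z: "br X3 z0' = Y1" "br X3 z1' = w'"
    unfolding z by (simp_all add: eX3[of Y3] gen Yw h3 hw br_linear)
  have ww: "br X1 w' = 0" "br w Y1 = 0" "br w w' = S (- a) h1"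
  proof -
    have "br X1 w' = br w' X1" by (rule odd_sym[OF odd(1) oddw(2)])
    also have "\<dots> = 0"
      unfolding w ad_Y2 using odd_sym[OF odd(2,1)] by (simp add: gen yx yh)
    finally show 1: "br X1 w' = 0" .
    show "br w Y1 = 0" unfolding w ad_X2 by (simp add: gen yh)
    show "br w w' = S (- a) h1" unfolding w(1) ad_X2 by (simp add: 1 Yw gen br_linear)
  qed
  have yw: "br Y1 X1 = h1" "br Y1 w = 0" "br w' X1 = 0" "br w' w = S (- a) h1"
    using odd_sym[OF odd(2,1)] odd_sym[OF odd(2) oddw(1)] odd_sym[OF oddw(2) odd(1)] odd_sym[OF oddw(2,1)]
    by (simp_all add: gen ww)
  have zw: "br z0' X1 = S t Y3" "br z0' w = 0" "br z1' X1 = 0" "br z1' w = S (- a * t) Y3"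
    unfolding z by (simp_all add: ad_Y3 yw yx Yw yh br_linear)
  have wz: "br Y1 z0 = S (- t) X3" "br Y1 z1 = 0" "br w' z0 = 0" "br w' z1 = S (a * t) X3"
    using odd_sym[OF odd(2) oddz(1)] odd_sym[OF odd(2) oddz(3)] odd_sym[OF oddw(2) oddz(1)] odd_sym[OF oddw(2) oddz(3)]
      odd_sym[OF odd(2,1)] odd_sym[OF odd(2) oddw(1)]
    by (simp_all add: z ad_X3 gen ww yh Yw br_linear)
  have zz: "br z0' z0 = S t h3 - h1" "br z0' z1 = 0" "br z1' z0 = 0" "br z1' z1 = S (- a) (S t h3 - h1)"
    unfolding z(3,4) by (simp_all add: ad_Y3 Y3z wz yw br_linear yx scale_right_diff_distrib)
  have hX: "br X1 h1 = 0" "br X1 h3 = X1" "br w h1 = 0" "br w h3 = w" "br X1 X3 = - z0" "br w X3 = - z1"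
    using even_skew[OF even(5), of X1] even_skew[OF even(7), of X1] even_skew[OF even(5), of w] even_skew[OF even(7), of w]
      even_skew[OF even(3), of X1] even_skew[OF even(3), of w]
    by (simp_all add: h1 h3 hw z)
  have hz: "br h1 z1 = S t z1" "br h1 z0 = S t z0"
    unfolding z by (simp_all add: even_jacobi[OF even(5)] h1 hw br_linear)
  \<comment> \<open>Each of the four odd factors of \<open>F\<close> sends \<open>E\<close> to a
    multiple of a single entry of the array. Expanding \<open>F\<close> by the odd Jacobi identity
    then gives \<open>br F E\<close> from pairings already known.\<close>
  have YE: "br Y1 E = S (2 * t) z1" "br w' E = S (2 * a * t) z0" "br z1' E = S (2 * a * t) X1" "br z0' E = S (2 * t) w"
    unfolding EF
    by (simp_all add: br_linear odd_jacobi[OF odd(2) odd(1)] odd_jacobi[OF odd(2) oddw(1)]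
        odd_jacobi[OF oddw(2) odd(1)] odd_jacobi[OF oddw(2) oddw(1)]
        odd_jacobi[OF oddz(2) odd(1)] odd_jacobi[OF oddz(2) oddw(1)]
        odd_jacobi[OF oddz(4) odd(1)] odd_jacobi[OF oddz(4) oddw(1)]
        yw zw wz zz hX hz Y3z algebra_simps flip: scale_left_distrib)
  have ad_odd: "br (br u v) E = br u (br v E) + br v (br u E)" if "u \<in> G True" "v \<in> G True" for u v
    using odd_jacobi[OF that] by simp
  have "br F E = S (4 * a * t) (S 2 h1 - S t h3)"
    unfolding EF(2) br_diff_left
    by (simp add: ad_odd odd oddw oddz YE br_linear yw zw wz zz algebra_simps flip: scale_left_distrib)
  moreover have "br E F = - br F E" by (rule even_skew) fact
  ultimately show "br E F = S (- 4 * a * t) (S 2 h1 - S t h3)" by simp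
qed

end

text \<open>This excludes the matrices that reflections leave open. The weight of \<open>F\<close>
  under \<open>hh j\<close> is \<mu> = 2a - 2, and the last two conditions on \<open>a\<close> say
  that \<mu> is neither 0 nor 1, as the three-member family requires.\<close>

lemma contragredient_not_finite_growth:
  assumes con: "is_contragredient n A p S br G hs al hh X Y"
    and idx: "k \<in> {1..n}" "j \<in> {1..n}" "l \<in> {1..n}" "k \<noteq> j" "k \<noteq> l" "j \<noteq> l"
    and par: "p k" "\<not> p j" "\<not> p l"
    and Ak: "A k k = 0" "A k j = 0" "A k l \<noteq> 0"
    and Aj: "A j k = - a" "A j j = 2" "A j l = 0"
    and Al: "A l k = -1" "A l j = 0" "A l l = 2"
    and a: "a \<noteq> 0" "a \<noteq> 1" "2 * a \<noteq> 3"
  shows "\<not> finite_growth n S br hs X Y"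
proof -
  note con' = con[unfolded is_contragredient_def]
  interpret super_lie S br G
    by standard (use con' in \<open>elim conjE\<close>)
  have hs: "hs \<subseteq> G False" using con' by (elim conjE)
  have hh: "hh i \<in> hs" if "i \<in> {1..n}" for i
  proof -
    have "\<forall>i\<in>{1..n}. hh i \<in> hs" using con' by (elim conjE)
    then show ?thesis using that ..
  qed
  have alhh: "al j (hh i) = A i j" if "i \<in> {1..n}" "j \<in> {1..n}" for i j
  proof -
    have "\<forall>i\<in>{1..n}. \<forall>j\<in>{1..n}. al j (hh i) = A i j" using con' by (elim conjE)
    then show ?thesis using that by blast
  qed
  have XG: "X i \<in> G (p i)" and YG: "Y i \<in> G (p i)" if "i \<in> {1..n}" for i
  proof -
    have "\<forall>i\<in>{1..n}. X i \<in> G (p i) \<and> Y i \<in> G (p i)" using con' by (elim conjE)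
    then show "X i \<in> G (p i)" "Y i \<in> G (p i)" using that by blast+
  qed
  have hX: "br (hh i) (X j) = S (A i j) (X j)" if "i \<in> {1..n}" "j \<in> {1..n}" for i j
  proof -
    have "\<forall>i\<in>{1..n}. \<forall>h\<in>hs. br h (X i) = S (al i h) (X i)" using con' by (elim conjE)
    then show ?thesis using that hh[of i] alhh[of i j] by simp
  qed
  have hY: "br (hh i) (Y j) = S (- A i j) (Y j)" if "i \<in> {1..n}" "j \<in> {1..n}" for i j
  proof -
    have "\<forall>i\<in>{1..n}. \<forall>h\<in>hs. br h (Y i) = S (- al i h) (Y i)" using con' by (elim conjE)
    then show ?thesis using that hh[of i] alhh[of i j] by simp
  qed
  have XY: "br (X i) (Y j) = (if i = j then hh i else 0)" if "i \<in> {1..n}" "j \<in> {1..n}" for i j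
  proof -
    have "\<forall>i\<in>{1..n}. \<forall>j\<in>{1..n}. br (X i) (Y j) = (if i = j then hh i else 0)" using con' by (elim conjE)
    then show ?thesis using that by blast
  qed
  have odd: "X k \<in> G True" "Y k \<in> G True" using XG[OF idx(1)] YG[OF idx(1)] par by simp_all
  have even: "X j \<in> G False" "Y j \<in> G False" "X l \<in> G False" "Y l \<in> G False"
    using XG[OF idx(2)] YG[OF idx(2)] XG[OF idx(3)] YG[OF idx(3)] par by simp_all
  have heven: "hh k \<in> G False" "hh j \<in> G False" "hh l \<in> G False" using hh hs idx by blast+
  define t where "t = A k l"
  have t: "t \<noteq> 0" "A k l = t" using Ak(3) by (simp_all add: t_def)
  define w w' where w: "w = br (X j) (X k)" "w' = br (Y j) (Y k)"
  define z0 z1 z0' z1' where z: "z0 = br (X l) (X k)" "z1 = br (X l) w" "z0' = br (Y l) (Y k)" "z1' = br (Y l) w'"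
  define E F where EF: "E = br (X k) z1 - br w z0" "F = br (Y k) z1' - br w' z0'"
  \<comment> \<open>This is the value of \<open>br E F\<close>. The combination 2 h_k - t h_l
    commutes with \<open>X j\<close> and \<open>X l\<close> and scales \<open>X k\<close>, so
    \<open>c\<close> has eigenvalue \<open>s / 2\<close> on \<open>X k\<close> and \<open>s\<close>
    on \<open>E\<close>, which is quadratic in \<open>X k\<close>.\<close>
  define c where "c = S (- 4 * a * t) (S 2 (hh k) - S t (hh l))"
  define s where "s = - 8 * a * t * t"
  have rel: "br (X k) (Y k) = hh k" "br (X j) (Y j) = hh j" "br (X l) (Y l) = hh l"
    "br (X k) (Y j) = 0" "br (X k) (Y l) = 0" "br (X j) (Y k) = 0" "br (X j) (Y l) = 0"
    "br (X l) (Y k) = 0" "br (X l) (Y j) = 0"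
    "br (hh k) (X k) = 0" "br (hh k) (Y k) = 0" "br (hh k) (X j) = 0" "br (hh k) (Y j) = 0"
    "br (hh k) (X l) = S t (X l)" "br (hh k) (Y l) = S (- t) (Y l)"
    "br (hh j) (X k) = S (- a) (X k)" "br (hh j) (Y k) = S a (Y k)" "br (hh j) (X l) = 0" "br (hh j) (Y l) = 0"
    "br (hh l) (X k) = - X k" "br (hh l) (Y k) = Y k" "br (hh l) (X j) = 0" "br (hh l) (Y j) = 0"
    using idx Ak Aj Al t by (simp_all add: XY hX hY)
  note sq = skew_square_bracket[OF odd even heven rel w z EF, folded c_def]
  have cX: "br c (X j) = 0" "br c (Y j) = 0" "br c (X k) = S (s / 2) (X k)" "br c (X l) = 0"
      "br c (Y k) = S (- s / 2) (Y k)" "br c (Y l) = 0"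
    using idx Ak Aj Al t by (simp_all add: c_def s_def br_linear hX hY algebra_simps)
  have c: "c \<in> G False" unfolding c_def
    by (intro subspace_scale[OF subspace_G] subspace_diff[OF subspace_G] heven)
  note eig = even_eigen_br[OF c] even_eigen_br[OF heven(2)]
  have cw: "br c w = S (s / 2) w" "br c w' = S (- s / 2) w'"
    unfolding w using eig(1)[of "X j" 0 "X k" "s / 2"] eig(1)[of "Y j" 0 "Y k" "- s / 2"] cX by simp_all
  have cz: "br c z0 = S (s / 2) z0" "br c z0' = S (- s / 2) z0'" "br c z1 = S (s / 2) z1" "br c z1' = S (- s / 2) z1'"
    unfolding z using eig(1)[of "X l" 0 "X k" "s / 2"] eig(1)[of "Y l" 0 "Y k" "- s / 2"]
     eig(1)[of "X l" 0 w "s / 2"] eig(1)[of "Y l" 0 w' "- s / 2"] cX cw by simp_all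
  have cE: "br c E = S s E" "br c F = S (- s) F"
    unfolding EF br_diff_right
    using eig(1)[OF cX(3) cz(3)] eig(1)[OF cw(1) cz(1)] eig(1)[OF cX(5) cz(4)] eig(1)[OF cw(2) cz(2)]
    by (simp_all add: scale_right_diff_distrib flip: minus_add_distrib)
  have hw: "br (hh j) (Y k) = S a (Y k)" "br (hh j) (Y l) = S 0 (Y l)" "br (hh j) (Y j) = S (- 2) (Y j)"
    using idx Aj by (simp_all add: hY)
  have hw': "br (hh j) w' = S (a - 2) w'" "br (hh j) z0' = S a z0'" 
    unfolding w z using eig(2)[OF hw(3,1)] eig(2)[OF hw(2,1)] by (simp_all add: algebra_simps)
  have hz1: "br (hh j) z1' = S (a - 2) z1'"
    unfolding z using eig(2)[OF hw(2) hw'(1)] by simp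
  have hF: "br (hh j) F = S (2 * a - 2) F"
  proof -
    have "a + (a - 2) = 2 * a - 2" "a - 2 + a = 2 * a - 2" by simp_all
    then show ?thesis
      unfolding EF(2) br_diff_right
      using eig(2)[OF hw(1) hz1] eig(2)[OF hw'] by (simp only: scale_right_diff_distrib)
  qed
  \<comment> \<open>If \<open>c\<close> were zero, its nonzero eigenvalue on \<open>X k\<close>
    would force \<open>X k = 0\<close>, hence \<open>hh k = 0\<close>, against
    \<open>al l (hh k) = t\<close>. Linearity of \<open>al l\<close> is what gives the value 0 at
    0.\<close>
  have "c \<noteq> 0"
  proof
    assume "c = 0"
    then have "X k = 0" using cX(3) a t by (simp add: s_def)
    then have 0: "hh k = 0" using XY[OF idx(1,1)] by simp
    have "\<forall>i\<in>{1..n}. \<forall>c. \<forall>x\<in>hs. \<forall>y\<in>hs. al i (S c x + y) = c * al i x + al i y"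
      using con' by (elim conjE)
    then have "al l (S 1 (hh k) + hh k) = 1 * al l (hh k) + al l (hh k)"
      using idx hh by blast
    then show False using t alhh[OF idx(1,3)] 0 by simp
  qed
  let ?x = "\<lambda>i. (br (X j) ^^ i) E"
  have df: "dual_family c s {..<3::nat} ?x
           (\<lambda>i. S (if i = 0 then 1 else if i = 1 then - 1 / (2 * a - 2)
              else 1 / (2 * (2 * a - 2) * (2 * a - 2 - 1))) ((br (Y j) ^^ i) F))"
    using idx a t \<open>c \<noteq> 0\<close> by (intro sl2_dual_family[OF even(1,2) heven(2) sq(4,5) c])
     (simp_all add: XY hw sq hF cX cE s_def field_simps)
  let ?P = "principal_component n S br hs X Y"
  have gen: "X i \<in> ?P 1" if "i \<in> {1..n}" for i
    unfolding principal_component_def using that by (intro span_base) (simp add: principal_monomial.genX)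
  have deg: "w \<in> ?P (1 + 1)" "z0 \<in> ?P (1 + 1)" "z1 \<in> ?P (1 + (1 + 1))"
    unfolding w z by (intro br_principal_component gen idx)+
  have "E \<in> ?P 4"
    using br_principal_component[OF gen[OF idx(1)] deg(3)] br_principal_component[OF deg(1,2)]
    unfolding EF principal_component_def by (simp add: span_diff)
  then have degx: "?x i \<in> ?P (int (4 + i))" for i
  proof (induction i)
    case (Suc i)
    then show ?case using br_principal_component[OF gen[OF idx(2)] Suc.IH] by (simp add: add_ac)
  qed simp
  show ?thesis
  \<comment> \<open>\<open>E\<close> has degree 4, being made from two \<open>X k\<close>, one
    \<open>X j\<close> and one \<open>X l\<close>; at most two further brackets with
    \<open>X j\<close> give 6.\<close>
  proof (rule dual_family_not_finite_growth[OF df, of 6])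
    show "\<exists>m \<le> 6. ?x i \<in> ?P (int m)" if "i \<in> {..<3}" for i
      using degx[of i] that by (intro exI[of _ "4 + i"]) simp
  qed simp_all
qed

section \<open>Odd reflections at a singular index\<close>

lemma reachable_by_odd_refl_trans:
  assumes "reachable_by_odd_refl n B q C r" "reachable_by_odd_refl n A p B q"
  shows "reachable_by_odd_refl n A p C r"
  using assms by (induction rule: reachable_by_odd_refl.induct) (auto intro: reachable_by_odd_refl.step)

lemma admissible_conds: "admissible n A p \<Longrightarrow> conds_C1_C4 n A p"
  by (auto simp: admissible_def intro: reachable_by_odd_refl.refl)

lemma admissible_C1: "admissible n A p \<Longrightarrow> i \<in> {1..n} \<Longrightarrow> A i i = 0 \<or> A i i = 2"
  and admissible_C2: "admissible n A p \<Longrightarrow> i \<in> {1..n} \<Longrightarrow> A i i = 0 \<Longrightarrow> p i"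
  and admissible_C3: "admissible n A p \<Longrightarrow> i \<in> {1..n} \<Longrightarrow> j \<in> {1..n} \<Longrightarrow> i \<noteq> j \<Longrightarrow> A i i = 2 \<Longrightarrow>
    \<exists>m \<ge> 0. A i j = - of_int ((if p i then 2 else 1) * m)"
  and admissible_C4: "admissible n A p \<Longrightarrow> i \<in> {1..n} \<Longrightarrow> j \<in> {1..n} \<Longrightarrow> A i j = 0 \<Longrightarrow> A j i \<noteq> 0 \<Longrightarrow> A i i = 0"
proof -
  assume "admissible n A p"
  then have conds: "cond_C1 n A p" "cond_C2 n A p" "cond_C3 n A p" "cond_C4 n A p"
    using admissible_conds by (auto simp: conds_C1_C4_def)
  show "i \<in> {1..n} \<Longrightarrow> A i i = 0 \<or> A i i = 2" using conds(1) by (simp add: cond_C1_def)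
  show "i \<in> {1..n} \<Longrightarrow> A i i = 0 \<Longrightarrow> p i" using conds(2) by (simp add: cond_C2_def)
  show "i \<in> {1..n} \<Longrightarrow> j \<in> {1..n} \<Longrightarrow> A i j = 0 \<Longrightarrow> A j i \<noteq> 0 \<Longrightarrow> A i i = 0"
    using conds(4) unfolding cond_C4_def by blast
  assume ij: "i \<in> {1..n}" "j \<in> {1..n}" "i \<noteq> j" "A i i = 2"
  obtain m :: int where "m \<le> 0" "A i j = (if p i then 2 else 1) * of_int m"
    using conds(3)[unfolded cond_C3_def, rule_format, OF ij(1,4,2) ij(3)[symmetric]] by (elim exE conjE)
  then show "\<exists>m \<ge> 0. A i j = - of_int ((if p i then 2 else 1) * m)"
    by (intro exI[of _ "- m"]) auto
qed

lemma admissible_oddrefl: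
  assumes "admissible n A p" "isotropic n A p k"
  shows "admissible n (oddrefl_mat A k) (oddrefl_par A p k)"
proof -
  have step: "reachable_by_odd_refl n A p (oddrefl_mat A k) (oddrefl_par A p k)"
    using assms(2) by (intro reachable_by_odd_refl.step reachable_by_odd_refl.refl)
  have "conds_C1_C4 n B q" if "reachable_by_odd_refl n (oddrefl_mat A k) (oddrefl_par A p k) B q" for B q
    using assms(1) reachable_by_odd_refl_trans[OF that step] by (simp add: admissible_def)
  moreover from this[OF reachable_by_odd_refl.refl]
  have "\<forall>i\<in>{1..n}. oddrefl_mat A k i i = 0 \<or> oddrefl_mat A k i i = 2"
    by (simp add: conds_C1_C4_def cond_C1_def)
  ultimately show ?thesis unfolding admissible_def by blast
qed

lemma oddrefl_diag_zero_odd: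
  assumes "admissible n A p" "isotropic n A p k" "i \<in> {1..n}" "oddrefl_raw A k i i = 0"
  shows "oddrefl_par A p k i"
  using admissible_C2[OF admissible_oddrefl[OF assms(1,2)] assms(3)] assms(4)
  by (simp add: oddrefl_mat_def normalize_rows_def)

text \<open>Normalization cancels the common factor \<open>u\<close> of the row, so (C3) for the
  reflected matrix becomes an equation between integers. All later arguments test signs or
  divisibility in it.\<close>

lemma oddrefl_C3:
  assumes adm: "admissible n A p" "isotropic n A p k" "i \<in> {1..n}" "j \<in> {1..n}" "i \<noteq> j"
    and raw: "oddrefl_raw A k i i = u * of_int x" "oddrefl_raw A k i j = u * of_int y" "u \<noteq> 0" "x \<noteq> 0"
  obtains m where "m \<ge> 0" "2 * y = - (if oddrefl_par A p k i then 2 else 1) * m * x"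
proof -
  have "oddrefl_mat A k i i = 2"
    using raw by (simp add: oddrefl_mat_def normalize_rows_def)
  then obtain m where m: "m \<ge> 0" "oddrefl_mat A k i j = - of_int ((if oddrefl_par A p k i then 2 else 1) * m)"
    using admissible_C3[OF admissible_oddrefl[OF adm(1,2)] adm(3-5)] by blast
  have "oddrefl_mat A k i j = 2 * of_int y / of_int x"
    using raw by (simp add: oddrefl_mat_def normalize_rows_def)
  then have "(2 * of_int y :: complex) = - of_int ((if oddrefl_par A p k i then 2 else 1) * m) * of_int x"
    using m(2) raw(4) by (simp add: field_simps)
  then have "(of_int (2 * y) :: complex) = of_int (- (if oddrefl_par A p k i then 2 else 1) * m * x)"
    by (simp split: if_splits)
  then show thesis using that m(1) unfolding of_int_eq_iff by blast
qed

text \<open>The factor \<open>q\<close> cannot be 0, so m >= 2 (m - 1). Equations of this shape come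
  from (C3) in an odd row.\<close>

lemma double_mult_pred_eq:
  fixes m q :: int
  assumes "m = 2 * q * (m - 1)" "m \<ge> 2" "q \<ge> 0"
  shows "m = 2"
proof -
  have "q \<noteq> 0" using assms by auto
  then have "m - 1 \<le> q * (m - 1)" using assms mult_right_mono[of 1 q "m - 1"] by simp
  moreover define r where "r = q * (m - 1)"
  moreover have "m = 2 * r" using assms(1) by (simp add: r_def)
  ultimately have "m \<le> 2" by linarith
  then show ?thesis using assms(2) by simp
qed

section \<open>A singular index \<open>k\<close>, its witness \<open>j\<close> and a neighbour
  \<open>l\<close>\<close>

locale singular_triple =
  fixes n :: nat and A :: "nat \<Rightarrow> nat \<Rightarrow> complex" and p :: "nat \<Rightarrow> bool" and k j l :: nat
  assumes adm: "admissible n A p"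
    and idx: "k \<in> {1..n}" "j \<in> {1..n}" "l \<in> {1..n}" and ne: "k \<noteq> j" "k \<noteq> l" "j \<noteq> l"
    and k: "A k k = 0" "A k j = 0" "A k l \<noteq> 0" "p k" and jk: "A j k \<noteq> 0"
begin

lemma ne': "j \<noteq> k" "l \<noteq> k" "l \<noteq> j"
  using ne by auto

lemma iso_k: "isotropic n A p k"
  using idx k by (simp add: isotropic_def)

text \<open>Since \<open>A k j = 0\<close>, the reflection at \<open>k\<close> makes the diagonal
  entry of \<open>j\<close> vanish, while it flips the parity of \<open>j\<close>. By (C2) the new
  parity is odd, so the old one is even.\<close>

lemma j_even: "\<not> p j" and A_jj: "A j j = 2"
proof -
  have "oddrefl_raw A k j j = 0" using k jk ne' by (simp add: oddrefl_raw_def)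
  then have "oddrefl_par A p k j" by (rule oddrefl_diag_zero_odd[OF adm iso_k idx(2)])
  then show "\<not> p j" using jk ne' by (simp add: oddrefl_par_def)
  then show "A j j = 2" using admissible_C1[OF adm idx(2)] admissible_C2[OF adm idx(2)] by blast
qed

text \<open>Otherwise (C4) makes \<open>l\<close> isotropic, and the reflection at \<open>k\<close>
  keeps its zero diagonal but turns it even, against (C2).\<close>

lemma A_lk: "A l k \<noteq> 0"
proof
  assume lk: "A l k = 0"
  then have "A l l = 0" using admissible_C4[OF adm idx(3,1)] k by simp
  then have "oddrefl_raw A k l l = 0" "p l"
    using lk ne' admissible_C2[OF adm idx(3)] by (simp_all add: oddrefl_raw_def)
  then show False
    using oddrefl_diag_zero_odd[OF adm iso_k idx(3)] k ne' by (simp add: oddrefl_par_def)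
qed

lemma raw_k:
  "oddrefl_raw A k l k = A k l * - A l k"
  "oddrefl_raw A k l l = A k l * (A l l + 2 * A l k)"
  "oddrefl_raw A k l j = A k l * (A l j + A l k)"
  "oddrefl_par A p k l \<longleftrightarrow> \<not> p l"
  using k jk ne ne' by (simp_all add: oddrefl_raw_def oddrefl_par_def algebra_simps)

text \<open>With diagonal 2, the reflection at \<open>k\<close> gives row \<open>l\<close> the
  diagonal 2 - 4m and the \<open>j\<close> entry -2d - 2m up to a common factor. Both are negative,
  so the normalized entry is positive, against (C3).\<close>

lemma l_odd_diag:
  assumes "p l" shows "A l l = 0"
proof (rule ccontr)
  assume "A l l \<noteq> 0"
  then have ll: "A l l = 2" using admissible_C1[OF adm idx(3)] by blast
  obtain m where m: "m \<ge> 0" "A l k = - of_int (2 * m)"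
    using admissible_C3[OF adm idx(3,1) ne'(2) ll] assms by auto
  obtain d where d: "d \<ge> 0" "A l j = - of_int (2 * d)"
    using admissible_C3[OF adm idx(3,2) ne'(3) ll] assms by auto
  have m1: "m \<ge> 1" using A_lk m by (cases "m = 0") auto
  have x: "2 - 4 * m \<noteq> 0" by presburger
  have ll': "oddrefl_raw A k l l = A k l * of_int (2 - 4 * m)" using raw_k(2) by (simp add: ll m)
  obtain q where q: "q \<ge> 0" "4 * m = - (q * (2 - 4 * m))"
    by (rule oddrefl_C3[OF adm iso_k idx(3,1) ne'(2) ll' _ k(3) x, of "2 * m"])
       (use assms raw_k in \<open>auto simp: m\<close>)
  obtain r where r: "r \<ge> 0" "2 * (- 2 * d - 2 * m) = - (r * (2 - 4 * m))"
    by (rule oddrefl_C3[OF adm iso_k idx(3,2) ne'(3) ll' _ k(3) x, of "- 2 * d - 2 * m"])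
       (use assms raw_k in \<open>auto simp: m d\<close>)
  have "r * (2 - 4 * m) \<le> 0" using r(1) m1 by (intro mult_nonneg_nonpos) auto
  then have "2 * (- 2 * d - 2 * m) \<ge> 0" using r(2) by simp
  then show False using d(1) m1 by simp
qed

text \<open>The reflection at \<open>k\<close> bounds \<open>d\<close>; then the successive reflections at \<open>l\<close>, \<open>j\<close>, \<open>k\<close>
  force \<open>b = 1\<close>, \<open>d = 2\<close> and \<open>a = 1\<close>.\<close>
lemma l_odd:
  assumes "p l"
  shows "A j k = -1 \<and> A j l = -1 \<and> A l l = 0 \<and> A l j = -2 * A l k"
proof -
  have ll: "A l l = 0" using assms by (rule l_odd_diag)
  define t where "t = A k l"
  define c where "c = A l k"
  have tc: "t \<noteq> 0" "c \<noteq> 0" using k A_lk by (simp_all add: t_def c_def)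
  have kl: "A k l = t" and lk: "A l k = c" by (simp_all add: t_def c_def)
  obtain a where a: "a \<ge> 0" "A j k = - of_int a"
    using admissible_C3[OF adm idx(2,1) ne'(1) A_jj] j_even by auto
  obtain b where b: "b \<ge> 0" "A j l = - of_int b"
    using admissible_C3[OF adm idx(2,3) ne(3) A_jj] j_even by auto
  have a1: "a \<ge> 1" using jk a by (cases "a = 0") auto
  let ?A' = "oddrefl_mat A k" and ?p' = "oddrefl_par A p k"
  have adm': "admissible n ?A' ?p'" by (rule admissible_oddrefl[OF adm iso_k])
  have A': "?A' l l = 2" "?A' l j = A l j / c + 1"
    using raw_k tc by (simp_all add: oddrefl_mat_def normalize_rows_def ll kl lk field_simps)
  have A'j: "?A' j l = t * A j k"
    using k jk ne ne' by (simp add: oddrefl_mat_def normalize_rows_def oddrefl_raw_def kl)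
  obtain m where m: "m \<ge> 0" "?A' l j = - of_int m"
    using admissible_C3[OF adm' idx(3,2) ne'(3) A'(1)] assms raw_k(4) by auto
  have "m \<noteq> 0"
    using admissible_C4[OF adm' idx(3,2)] A' A'j m tc jk by auto
  \<comment> \<open>The reflected entry is a_lj / c + 1 = -m, so a_lj = -c (m + 1). As (C4) has
    excluded m = 0, \<open>d\<close> is at least 2.\<close>
  define d where "d = m + 1"
  have d: "d \<ge> 2" using m(1) \<open>m \<noteq> 0\<close> by (simp add: d_def)
  have lj: "A l j = - (c * of_int d)"
    using m(2) A'(2) tc by (simp add: d_def field_simps) (metis add.commute add_diff_cancel_left' uminus_add_conv_diff)
  have "b \<noteq> 0"
    using admissible_C4[OF adm idx(2,3)] b A_jj lj tc d by auto
  then have b1: "b \<ge> 1" using b by simp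
  have iso_l: "isotropic n A p l" using idx ll assms by (simp add: isotropic_def)
  have raw_l: "oddrefl_raw A l j j = c * of_int (- 2 * d * (1 - b))"
    "oddrefl_raw A l j l = c * of_int (- d * b)"
    "oddrefl_raw A l j k = c * of_int (a * d - b + b * d)"
    "oddrefl_raw A l k k = 2 * c * t" "oddrefl_raw A l k j = c * t * (1 - of_int d)" "oddrefl_raw A l k l = - c * t"
    using k tc a1 b1 d ne ne'
    by (simp_all add: oddrefl_raw_def kl lk lj a b ll A_jj algebra_simps)
  have par_l: "oddrefl_par A p l j" "\<not> oddrefl_par A p l k" "oddrefl_par A p l l"
    using k j_even b1 tc ne ne' b by (auto simp: oddrefl_par_def kl)
  \<comment> \<open>For b >= 2 the new diagonal of \<open>j\<close> is positive up to the factor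
    \<open>c\<close>. The \<open>l\<close> entry leaves only b = 2, and then the \<open>k\<close>
    entry has the forbidden positive sign.\<close>
  have "b = 1"
  proof (rule ccontr)
    assume "b \<noteq> 1"
    then have x: "- 2 * d * (1 - b) \<noteq> 0" and b2: "b \<ge> 2" using d b1 by auto
    obtain q where q: "q \<ge> 0" "2 * (- d * b) = - 2 * q * (- 2 * d * (1 - b))"
      by (rule oddrefl_C3[OF adm iso_l idx(2,3) ne(3) raw_l(1,2) tc(2) x]) (use par_l in auto)
    have "d * b = d * (2 * q * (b - 1))" using q(2) by (simp add: algebra_simps)
    then have "b = 2 * q * (b - 1)" using d by simp
    then have b: "b = 2" using b2 q(1) by (rule double_mult_pred_eq)
    obtain r where r: "r \<ge> 0" "2 * (a * d - b + b * d) = - 2 * r * (- 2 * d * (1 - b))"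
      by (rule oddrefl_C3[OF adm iso_l idx(2,1) ne'(1) raw_l(1,3) tc(2) x]) (use par_l in auto)
    have "a * d \<ge> 0" "r * d \<ge> 0" using a r d by simp_all
    then show False using r(2) d b by simp
  qed
  \<comment> \<open>For b = 1 this is the \<open>k\<close> entry of row \<open>j\<close> up to the
    factor \<open>c\<close>; the diagonal of \<open>j\<close> is now 0 and \<open>j\<close> is odd,
    so it can be reflected next.\<close>
  define e where "e = d * (a + 1) - 1"
  have "2 * (1 + 1) \<le> d * (a + 1)" using d a1 by (intro mult_mono) auto
  then have e: "e \<ge> 3" by (simp add: e_def)
  define B where "B = oddrefl_mat A l"
  define q where "q = oddrefl_par A p l"
  have B: "B k k = 2" "B k j = 1 - of_int d" "B k l = -1"
    "B j k = c * of_int e" "B j j = 0" "B j l = - (c * of_int d)"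
    "B l k = c" "B l j = - (c * of_int d)" "B l l = 0"
    using raw_l tc d \<open>b = 1\<close>
    by (simp_all add: B_def oddrefl_mat_def normalize_rows_def e_def field_simps)
       (simp_all add: oddrefl_raw_def lk lj ll)
  have q: "q j" "\<not> q k" "q l" using par_l by (simp_all add: q_def)
  have admB: "admissible n B q" unfolding B_def q_def by (rule admissible_oddrefl[OF adm iso_l])
  have iso_j: "isotropic n B q j" using idx B q by (simp add: isotropic_def)
  have raw_j: "oddrefl_raw B j k k = c * of_int (2 * e * (2 - d))"
    "oddrefl_raw B j k j = c * of_int (e * (d - 1))"
    "oddrefl_raw B j k l = c * of_int (d * (d - 1 - e))"
    "oddrefl_raw B j l l = 2 * c * c * of_int (d * d)"
    "oddrefl_raw B j l j = - (c * c * of_int (d * d))"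
    "oddrefl_raw B j l k = c * c * of_int (d * (d - 1 - e))"
    using tc d e ne ne' by (simp_all add: oddrefl_raw_def B algebra_simps)
  have par_j: "oddrefl_par B q j k" "\<not> oddrefl_par B q j l" "oddrefl_par B q j j"
    using q B tc d e ne ne' by (auto simp: oddrefl_par_def)
  \<comment> \<open>For d >= 3 the diagonal of \<open>k\<close> is negative. Its \<open>j\<close>
    entry leaves only d = 3, and its \<open>l\<close> entry is then negative too, which (C3) forbids
    after normalization.\<close>
  have "d = 2"
  proof (rule ccontr)
    assume "d \<noteq> 2"
    then have x: "2 * e * (2 - d) \<noteq> 0" using e by simp
    obtain r where r: "r \<ge> 0" "2 * (e * (d - 1)) = - 2 * r * (2 * e * (2 - d))"
      by (rule oddrefl_C3[OF admB iso_j idx(1,2) ne(1) raw_j(1,2) tc(2) x]) (use par_j in auto)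
    have "e * (d - 1) = e * (2 * r * (d - 1 - 1))" using r(2) by (simp add: algebra_simps)
    then have "d - 1 = 2 * r * (d - 1 - 1)" using e by simp
    then have "d - 1 = 2" by (rule double_mult_pred_eq) (use d r \<open>d \<noteq> 2\<close> in auto)
    then have d: "d = 3" by simp
    obtain s where s: "s \<ge> 0" "2 * (d * (d - 1 - e)) = - 2 * s * (2 * e * (2 - d))"
      by (rule oddrefl_C3[OF admB iso_j idx(1,3) ne(2) raw_j(1,3) tc(2) x]) (use par_j in auto)
    have "s * e \<ge> 0" using s e by simp
    then show False using s(2) d e by simp
  qed
  have e_a: "e = 2 * a + 1" by (simp add: e_def \<open>d = 2\<close>)
  define C where "C = oddrefl_mat B j"
  define r where "r = oddrefl_par B q j"
  have C: "C k k = 0" "C k j = c * of_int e" "C k l = - (4 * c * of_int a)" "C l l = 2"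
    "C l j = -1" "C l k = - of_int a"
    using raw_j tc \<open>d = 2\<close> e_a
    by (simp_all add: C_def oddrefl_mat_def normalize_rows_def field_simps)
  have r: "r k" "\<not> r l" using par_j by (simp_all add: r_def)
  have admC: "admissible n C r" unfolding C_def r_def by (rule admissible_oddrefl[OF admB iso_j])
  have iso_C: "isotropic n C r k" using idx C r by (simp add: isotropic_def)
  \<comment> \<open>For a >= 2 the reflection at \<open>k\<close> gives row \<open>l\<close> a
    diagonal and a \<open>j\<close> entry that are both positive multiples of \<open>c\<close>,
    against (C3).\<close>
  have "a = 1"
  proof (rule ccontr)
    assume "a \<noteq> 1"
    then have x: "8 * a * (a - 1) \<noteq> 0" and a2: "a \<ge> 2" using a1 by auto
    have rawC: "oddrefl_raw C k l l = c * of_int (8 * a * (a - 1))" "oddrefl_par C r k l"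
      using r tc a1 ne ne' by (simp_all add: oddrefl_raw_def oddrefl_par_def C(3-6) algebra_simps)
    have "oddrefl_raw C k l j = c * of_int (a * (4 + 4 * a - e))"
      using tc a1 e ne ne' by (simp add: oddrefl_raw_def C algebra_simps)
    also have "a * (4 + 4 * a - e) = a * (3 + 2 * a)" by (simp add: e_a)
    finally have rawC': "oddrefl_raw C k l j = c * of_int (a * (3 + 2 * a))" .
    obtain s where s: "s \<ge> 0" "2 * (a * (3 + 2 * a)) = - 2 * s * (8 * a * (a - 1))"
      by (rule oddrefl_C3[OF admC iso_C idx(3,2) ne'(3) rawC(1) rawC' tc(2) x]) (use rawC(2) in auto)
    have "s * (8 * a * (a - 1)) \<ge> 0" "a * (3 + 2 * a) > 0"
      using s(1) a2 by (intro mult_nonneg_nonneg mult_pos_pos; simp)+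
    moreover have "2 * (a * (3 + 2 * a)) = - (2 * (s * (8 * a * (a - 1))))" using s(2) by simp
    ultimately show False by linarith
  qed
  then show ?thesis using a b \<open>b = 1\<close> ll lj \<open>d = 2\<close> lk by simp
qed

text \<open>Reflecting at \<open>k\<close> yields diagonal 2 - 2m and entry -d - m in row
  \<open>l\<close>, and equality of signs rules out m >= 2. For m = 1 the index \<open>l\<close>
  becomes isotropic, and reflecting there gives row \<open>j\<close> the entries 2(d + 1) and
  \<open>d\<close> up to the factor \<open>u\<close>, so d = 0; (C4) then kills
  \<open>A j l\<close>. The value \<open>A j k\<close> enters this last test only through
  \<open>u\<close>.\<close>

lemma l_even:
  assumes "\<not> p l"
  shows "A l l = 2 \<and> A l k = -1 \<and> A l j = 0 \<and> A j l = 0"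
proof -
  have ll: "A l l = 2"
    using admissible_C1[OF adm idx(3)] admissible_C2[OF adm idx(3)] assms by blast
  define t where "t = A k l"
  have t: "t \<noteq> 0" and kl: "A k l = t" using k by (simp_all add: t_def)
  obtain m where m: "m \<ge> 0" "A l k = - of_int m"
    using admissible_C3[OF adm idx(3,1) ne'(2) ll] assms by auto
  obtain d where d: "d \<ge> 0" "A l j = - of_int d"
    using admissible_C3[OF adm idx(3,2) ne'(3) ll] assms by auto
  have m1: "m \<ge> 1" using A_lk m by (cases "m = 0") auto
  have raw: "oddrefl_raw A k l l = t * of_int (2 - 2 * m)" "oddrefl_raw A k l k = t * of_int m"
    "oddrefl_raw A k l j = t * of_int (- d - m)" "oddrefl_par A p k l"
    using raw_k assms by (simp_all add: kl ll m d)
  have "m = 1"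
  proof (rule ccontr)
    assume "m \<noteq> 1"
    then have x: "2 - 2 * m \<noteq> 0" and m2: "m \<ge> 2" using m1 by auto
    obtain r where r: "r \<ge> 0" "2 * (- d - m) = - 2 * r * (2 - 2 * m)"
      by (rule oddrefl_C3[OF adm iso_k idx(3,2) ne'(3) raw(1,3) t x]) (use raw(4) in auto)
    have "r * (2 - 2 * m) \<le> 0" using r m2 by (intro mult_nonneg_nonpos) auto
    then have "2 * (- d - m) \<ge> 0" using r(2) by simp
    then show False using d(1) m2 by simp
  qed
  define B where "B = oddrefl_mat A k"
  define q where "q = oddrefl_par A p k"
  have B: "B j k = 0" "B j j = 0" "B j l = t * A j k" "B l k = t" "B l j = - (t * of_int (d + 1))" "B l l = 0"
    using raw(1,2) k jk ne ne' \<open>m = 1\<close>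
    by (simp_all add: raw(3) B_def oddrefl_mat_def normalize_rows_def oddrefl_raw_def[of A k j] kl algebra_simps)
  have q: "q j" "q l" using j_even jk ne' raw(4) by (simp_all add: q_def oddrefl_par_def)
  have admB: "admissible n B q" unfolding B_def q_def by (rule admissible_oddrefl[OF adm iso_k])
  have iso_l: "isotropic n B q l" using idx B q by (simp add: isotropic_def)
  define u where "u = - (t * t * A j k)"
  have u: "u \<noteq> 0" using t jk by (simp add: u_def)
  have "d + 1 \<noteq> 0" using d(1) by linarith
  then have d1: "(1 + of_int d :: complex) \<noteq> 0" by (metis add.commute of_int_1 of_int_add of_int_eq_0_iff)
  have rawB: "oddrefl_raw B l j j = u * of_int (2 * (d + 1))" "oddrefl_raw B l j k = u * of_int d"
    "\<not> oddrefl_par B q l j"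
    using q t jk d1 ne ne' by (simp_all add: oddrefl_raw_def oddrefl_par_def B u_def algebra_simps)
  have x: "2 * (d + 1) \<noteq> 0" using d by simp
  obtain r where r: "r \<ge> 0" "2 * d = - (if oddrefl_par B q l j then 2 else 1) * r * (2 * (d + 1))"
    by (rule oddrefl_C3[OF admB iso_l idx(2,1) ne'(1) rawB(1,2) u x])
  have "r * (2 * (d + 1)) \<ge> 0" using r d by simp
  moreover have "2 * d = - (r * (2 * (d + 1)))" using r(2) rawB(3) by simp
  ultimately have "d = 0" using d(1) by linarith
  moreover from this have "A j l = 0"
    using admissible_C4[OF adm idx(3,2)] d ll by auto
  ultimately show ?thesis using ll m d \<open>m = 1\<close> by simp
qed

end

section \<open>The classification\<close>

lemma equiv_reorder_rescaleI:
  assumes idx: "{k, j, l} = {1..3::nat}" "k \<noteq> j" "k \<noteq> l" "j \<noteq> l"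
    and c: "u \<noteq> 0" "v \<noteq> 0" "w \<noteq> 0"
    and k: "u * A k k = B 1 1" "u * A k j = B 1 2" "u * A k l = B 1 3" "p k = q 1"
    and j: "v * A j k = B 2 1" "v * A j j = B 2 2" "v * A j l = B 2 3" "p j = q 2"
    and l: "w * A l k = B 3 1" "w * A l j = B 3 2" "w * A l l = B 3 3" "p l = q 3"
  shows "equiv_reorder_rescale 3 A p B q"
proof -
  have 3: "{1..3::nat} = {1, 2, 3}" by auto
  define \<sigma> where "\<sigma> i = (if i = 1 then k else if i = 2 then j else l)" for i :: nat
  define c where "c i = (if i = 1 then u else if i = 2 then v else w)" for i :: nat
  have "bij_betw \<sigma> {1..3} {1..3}"
    using idx unfolding bij_betw_def 3 by (auto simp: \<sigma>_def inj_on_def)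
  moreover have "\<forall>i\<in>{1..3}. \<forall>j\<in>{1..3}. c i * A (\<sigma> i) (\<sigma> j) = B i j"
    unfolding 3 using k j l by (simp add: \<sigma>_def c_def)
  moreover have "\<forall>i\<in>{1..3}. p (\<sigma> i) = q i" "\<forall>i\<in>{1..3}. c i \<noteq> 0"
    unfolding 3 using k j l c by (simp_all add: \<sigma>_def c_def)
  ultimately show ?thesis unfolding equiv_reorder_rescale_def by blast
qed

theorem theorem7p1:
  fixes A :: "nat \<Rightarrow> nat \<Rightarrow> complex" and p :: "nat \<Rightarrow> bool" and k :: nat
  assumes "indecomposable 3 A"
    and "elemental 3 A"
    and "admissible 3 A p"
    and "singular_isotropic 3 A p k"
    and "contragredient_finite_growth 3 A p TYPE('v::ab_group_add)"
  shows "equiv_reorder_rescale 3 A p S120_mat S120_par \<or>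
         equiv_reorder_rescale 3 A p D210_mat D210_par"
proof -
  obtain j where kj: "k \<in> {1..3}" "j \<in> {1..3}" "j \<noteq> k" "A k k = 0" "p k" "A k j = 0" "A j k \<noteq> 0"
    using assms(4) by (auto simp: singular_isotropic_def isotropic_def)
  obtain l where l: "l \<in> {1..3}" "A k l \<noteq> 0"
    using assms(2) kj(1) unfolding elemental_def by blast
  have ne: "k \<noteq> j" "k \<noteq> l" "j \<noteq> l" using kj l by auto
  have "finite {1..3::nat}" "{k, j, l} \<subseteq> {1..3}" "card {k, j, l} = card {1..3::nat}"
    using kj l ne by simp_all
  then have perm: "{k, j, l} = {1..3}" by (rule card_subset_eq)
  interpret singular_triple 3 A p k j l
    using assms(3) kj l ne by unfold_locales auto
  show ?thesis
  proof (cases "p l")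
    case True
    \<comment> \<open>Rows \<open>k\<close> and \<open>l\<close> have zero diagonal and are known
      only up to scalars, hence the two nontrivial factors.\<close>
    have "equiv_reorder_rescale 3 A p S120_mat S120_par"
      by (rule equiv_reorder_rescaleI[OF perm ne, of "1 / A k l" 1 "1 / A l k"])
         (use l_odd[OF True] True kj l A_lk A_jj j_even in \<open>simp_all add: S120_mat_def S120_par_def\<close>)
    then show ?thesis ..
  next
    case False
    note even = l_even[OF False]
    obtain a where a: "a \<ge> 0" "A j k = - of_int a"
      using admissible_C3[OF assms(3) kj(2,1,3) A_jj] j_even by auto
    have "a = 1"
    proof (rule ccontr)
      assume "a \<noteq> 1"
      then have a2: "a \<ge> 2" using a kj(7) by (cases "a = 0") auto
      \<comment> \<open>Integrality of \<open>a\<close> supplies the condition that \<mu> = 2a - 2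
        is not 1.\<close>
      have "2 * a \<noteq> 3" by presburger
      then have a3: "2 * of_int a \<noteq> (3 :: complex)"
        by (metis of_int_eq_iff of_int_mult of_int_numeral)
      obtain S :: "complex \<Rightarrow> 'v \<Rightarrow> 'v" and br G hs al hh X Y
        where con: "is_contragredient 3 A p S br G hs al hh X Y" and fg: "finite_growth 3 S br hs X Y"
        using assms(5) unfolding contragredient_finite_growth_def by blast
      have "\<not> finite_growth 3 S br hs X Y"
        by (rule contragredient_not_finite_growth[OF con kj(1,2) l(1) ne kj(5) j_even False kj(4,6) l(2) a(2) A_jj])
           (use even a2 a3 in auto)
      then show False using fg by contradiction
    qed
    have "equiv_reorder_rescale 3 A p D210_mat D210_par"
      by (rule equiv_reorder_rescaleI[OF perm ne, of "1 / A k l" 1 1])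
         (use even False kj l A_jj j_even a \<open>a = 1\<close> in \<open>simp_all add: D210_mat_def D210_par_def\<close>)
    then show ?thesis ..
  qed
qed

end
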